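(* Let $I$ be a finite set, $X\subseteq Y_2\times I^2$, $Z$ the complement of $X$ in $Y_2\times I^2$, and $\mathbb K$ a field. Let $\mathcal P$ be the operad over $\mathbb K$ determined by $X$ (with the elements of $Z$ as relations), and $\mathcal Q$ the operad obtained by exchanging the roles of $X$ and $Z$ (with the elements of $X$ as relations). Then $\mathcal P$ and $\mathcal Q$ are Koszul operads.
   Context: $Y_2=\{L,R\}$ is the set of planar binary rooted trees with two internal vertices: $L$ is the tree whose non-root vertex is the right child of the root vertex, $R$ is the tree whose non-root vertex is the left child of the root vertex. Elements of $Y_2\times I^2$ are written $(L;i,j)$ or $(R;i,j)$. The operad $\mathcal P$ is the operad over $\mathbb K$ whose algebras are the vector spaces equipped with one binary operation $\circ_i$ (without symmetry) for each $i\in I$, subject to the relations $$(x\circ_i y)\circ_j z=0\ \text{ if }(R;i,j)\in Z,\qquad x\circ_i(y\circ_j z)=0\ \text{ if }(L;i,j)\in Z.$$ It is a regular binary quadratic operad, i.e. it comes from a non-$\Sigma$ operad $(\mathcal P_n)_{n\ge1}$ via $\mathcal P(n)=\mathcal P_n\otimes\mathbb K[S_n]$, with $S_n$ the symmetric group. The operad $\mathcal Q$ is defined in the same way, with relations $$(x\circ_i y)\circ_j z=0\ \text{ if }(R;i,j)\in X,\qquad x\circ_i(y\circ_j z)=0\ \text{ if }(L;i,j)\in X.$$ A quadratic operad $\mathcal P$ is Koszul (in the sense of Ginzburg–Kapranov) if its Koszul complex $(\mathcal P^{!*}(\mathcal P(V)),\delta)$ is acyclic for every vector space $V$, i.e.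 its homology is just $V$, concentrated in degree $1$; here $\mathcal P^!$ is the Koszul dual operad. For a regular operad it is sufficient to check the case $V=\mathbb K$. *)

theory Defs
  imports Complex_Main "HOL-Library.Poly_Mapping"
begin

section \<open>Free vector spaces\<close>

text \<open>
  The type \<open>'a \<Rightarrow>\<^sub>0 'k\<close> of finitely supported functions is the vector space over the field \<open>'k\<close>
  with basis \<open>'a\<close>.
\<close>

definition scale :: "'k::field \<Rightarrow> ('a \<Rightarrow>\<^sub>0 'k) \<Rightarrow> ('a \<Rightarrow>\<^sub>0 'k)" where
  "scale c x = Poly_Mapping.map ((*) c) x"

lemma lookup_scale [simp]: "Poly_Mapping.lookup (scale c x) a = c * Poly_Mapping.lookup x a"
  by (simp add: scale_def Poly_Mapping.map.rep_eq when_def)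

global_interpretation free_vs: vector_space "scale :: 'k::field \<Rightarrow> ('a \<Rightarrow>\<^sub>0 'k) \<Rightarrow> ('a \<Rightarrow>\<^sub>0 'k)"
  by unfold_locales (auto intro!: poly_mapping_eqI simp: lookup_add algebra_simps)

definition lin_ext :: "('a \<Rightarrow> ('b \<Rightarrow>\<^sub>0 'k::field)) \<Rightarrow> ('a \<Rightarrow>\<^sub>0 'k) \<Rightarrow> ('b \<Rightarrow>\<^sub>0 'k)" where
  "lin_ext f x = (\<Sum>a\<in>Poly_Mapping.keys x. scale (Poly_Mapping.lookup x a) (f a))"

definition bilin_ext ::
    "('a \<Rightarrow> 'b \<Rightarrow> 'c) \<Rightarrow> ('a \<Rightarrow>\<^sub>0 'k::field) \<Rightarrow> ('b \<Rightarrow>\<^sub>0 'k) \<Rightarrow> ('c \<Rightarrow>\<^sub>0 'k)" where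
  "bilin_ext f x y =
    (\<Sum>a\<in>Poly_Mapping.keys x. \<Sum>b\<in>Poly_Mapping.keys y.
      Poly_Mapping.single (f a b) (Poly_Mapping.lookup x a * Poly_Mapping.lookup y b))"

text \<open>
  Tensor products of free vector spaces, through the basis formed by the pairs (respectively the
  lists) of basis elements.
\<close>

abbreviation tensor :: "('a \<Rightarrow>\<^sub>0 'k::field) \<Rightarrow> ('b \<Rightarrow>\<^sub>0 'k) \<Rightarrow> ('a \<times> 'b \<Rightarrow>\<^sub>0 'k)" where
  "tensor \<equiv> bilin_ext Pair"

fun tensor_list :: "('a \<Rightarrow>\<^sub>0 'k::field) list \<Rightarrow> ('a list \<Rightarrow>\<^sub>0 'k)" where
  "tensor_list [] = Poly_Mapping.single [] 1"
| "tensor_list (x # xs) = bilin_ext (#) x (tensor_list xs)"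

text \<open>
  Evaluation of a linear functional, given by its (finitely supported) coordinates in the dual basis.
\<close>

definition eval_dual :: "('a \<Rightarrow>\<^sub>0 'k::field) \<Rightarrow> ('a \<Rightarrow>\<^sub>0 'k) \<Rightarrow> 'k" where
  "eval_dual f x = (\<Sum>a\<in>Poly_Mapping.keys x. Poly_Mapping.lookup f a * Poly_Mapping.lookup x a)"


section \<open>The free non-symmetric operad on a set of binary generators\<close>

datatype (labels: 'i) pbt = Leaf | Node 'i "'i pbt" "'i pbt"

fun leaves :: "'i pbt \<Rightarrow> nat" where
  "leaves Leaf = 1"
| "leaves (Node i l r) = leaves l + leaves r"

definition trees :: "'i set \<Rightarrow> nat \<Rightarrow> 'i pbt set" where
  "trees I n = {t. labels t \<subseteq> I \<and> leaves t = n}"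

definition free_op :: "'i set \<Rightarrow> nat \<Rightarrow> ('i pbt \<Rightarrow>\<^sub>0 'k::field) set" where
  "free_op I n = {x. Poly_Mapping.keys x \<subseteq> trees I n}"

text \<open>Grafting on the \<open>k\<close>-th leaf; the leaves are numbered from left to right, starting with 0.\<close>

fun graft :: "'i pbt \<Rightarrow> nat \<Rightarrow> 'i pbt \<Rightarrow> 'i pbt" where
  "graft Leaf k t = t"
| "graft (Node i l r) k t =
    (if k < leaves l then Node i (graft l k t) r else Node i l (graft r (k - leaves l) t))"

text \<open>The partial compositions of the free operad.\<close>

definition comp_op :: "('i pbt \<Rightarrow>\<^sub>0 'k::field) \<Rightarrow> nat \<Rightarrow> ('i pbt \<Rightarrow>\<^sub>0 'k) \<Rightarrow> ('i pbt \<Rightarrow>\<^sub>0 'k)" where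
  "comp_op x k y = bilin_ext (\<lambda>s t. graft s k t) x y"

definition generator :: "'i \<Rightarrow> ('i pbt \<Rightarrow>\<^sub>0 'k::field)" where
  "generator i = Poly_Mapping.single (Node i Leaf Leaf) 1"


section \<open>Regular binary quadratic operads\<close>

text \<open>
  A regular binary quadratic operad is presented by a set of binary generators \<open>gens\<close> (a basis of
  the space of generating operations) and a set \<open>rels\<close> of quadratic relators, which lie in the
  arity 3 component of the free non-symmetric operad.  The operad presented by \<open>P\<close> has as its
  arity \<open>n\<close> component the quotient of \<open>free_op (gens P) n\<close> by \<open>{x. op_ideal P n x}\<close>, where
  \<open>op_ideal P\<close> is the operadic ideal generated by the relators.
\<close>

record (overloaded) ('i, 'k) quadratic =
  gens :: "'i set"
  rels :: "('i pbt \<Rightarrow>\<^sub>0 'k) set"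

inductive op_ideal :: "('i, 'k::field) quadratic \<Rightarrow> nat \<Rightarrow> ('i pbt \<Rightarrow>\<^sub>0 'k) \<Rightarrow> bool"
  for P :: "('i, 'k) quadratic"
where
  rel: "r \<in> rels P \<Longrightarrow> op_ideal P 3 r"
| zero: "op_ideal P n 0"
| add: "op_ideal P n x \<Longrightarrow> op_ideal P n y \<Longrightarrow> op_ideal P n (x + y)"
| scale: "op_ideal P n x \<Longrightarrow> op_ideal P n (scale c x)"
| comp_left: "op_ideal P m x \<Longrightarrow> y \<in> free_op (gens P) n \<Longrightarrow> k < m \<Longrightarrow>
    op_ideal P (m + n - 1) (comp_op x k y)"
| comp_right: "x \<in> free_op (gens P) m \<Longrightarrow> op_ideal P n y \<Longrightarrow> k < m \<Longrightarrow>
    op_ideal P (m + n - 1) (comp_op x k y)"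

text \<open>
  The linear dual of the arity \<open>n\<close> component of the operad presented by \<open>P\<close>: the functionals on the
  free operad that vanish on the ideal.  For a finite set of generators there are only finitely
  many trees of a given arity, so that every functional is finitely supported.
\<close>

definition dual_component :: "('i, 'k::field) quadratic \<Rightarrow> nat \<Rightarrow> ('i pbt \<Rightarrow>\<^sub>0 'k) set" where
  "dual_component P n =
    {f \<in> free_op (gens P) n. \<forall>x. op_ideal P n x \<longrightarrow> eval_dual f x = 0}"

text \<open>
  \<open>TL\<close> and \<open>TR\<close> are the trees \<open>L\<close> and \<open>R\<close>.  In a decorated tree \<open>(T; i, j)\<close> the operations are read
  as in the monomials \<open>x \<circ>\<^sub>i (y \<circ>\<^sub>j z)\<close> for \<open>L\<close> and \<open>(x \<circ>\<^sub>i y) \<circ>\<^sub>j z\<close> for \<open>R\<close>, from left to right: \<open>i\<close>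
  decorates the root of \<open>L\<close>, but the non-root vertex of \<open>R\<close>.
\<close>

datatype Y2 = TL | TR

fun quad_tree :: "Y2 \<times> 'i \<times> 'i \<Rightarrow> 'i pbt" where
  "quad_tree (TL, i, j) = Node i Leaf (Node j Leaf Leaf)"
| "quad_tree (TR, i, j) = Node j (Node i Leaf Leaf) Leaf"

text \<open>
  The Koszul dual is generated by the dual basis (again indexed by \<open>gens P\<close>), subject to the
  orthogonal of the relations.  For regular operads, the sign twist in the Ginzburg-Kapranov
  pairing amounts to the sign \<open>+\<close> on \<open>R\<close> and \<open>-\<close> on \<open>L\<close>.
\<close>

definition quad_pairing ::
    "'i set \<Rightarrow> ('i pbt \<Rightarrow>\<^sub>0 'k::field) \<Rightarrow> ('i pbt \<Rightarrow>\<^sub>0 'k) \<Rightarrow> 'k" where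
  "quad_pairing I y x =
    (\<Sum>(i, j)\<in>I \<times> I.
      Poly_Mapping.lookup y (quad_tree (TR, i, j)) * Poly_Mapping.lookup x (quad_tree (TR, i, j))
      - Poly_Mapping.lookup y (quad_tree (TL, i, j)) * Poly_Mapping.lookup x (quad_tree (TL, i, j)))"

definition koszul_dual :: "('i, 'k::field) quadratic \<Rightarrow> ('i, 'k) quadratic" where
  "koszul_dual P =
    \<lparr>gens = gens P,
     rels = {y \<in> free_op (gens P) 3. \<forall>x\<in>rels P. quad_pairing (gens P) y x = 0}\<rparr>"


section \<open>Free algebras\<close>

text \<open>
  A vector space \<open>V\<close> is given by a basis \<open>B\<close>.  The free algebra
  \<open>P(V) = (\<Oplus>n. P\<^sub>n \<otimes> V\<^sup>\<otimes>\<^sup>n)\<close> is the quotient of \<open>free_alg (gens P) B\<close>, the corresponding direct sum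
  for the free operad, by \<open>null_alg P B\<close>.
\<close>

definition vspace :: "'v set \<Rightarrow> ('v \<Rightarrow>\<^sub>0 'k::field) set" where
  "vspace B = {v. Poly_Mapping.keys v \<subseteq> B}"

definition free_alg :: "'i set \<Rightarrow> 'v set \<Rightarrow> ('i pbt \<times> 'v list \<Rightarrow>\<^sub>0 'k::field) set" where
  "free_alg I B = free_vs.span
    {tensor x (tensor_list vs) | x vs. x \<in> free_op I (length vs) \<and> set vs \<subseteq> vspace B}"

definition null_alg :: "('i, 'k::field) quadratic \<Rightarrow> 'v set \<Rightarrow> ('i pbt \<times> 'v list \<Rightarrow>\<^sub>0 'k) set" where
  "null_alg P B = free_vs.span
    {tensor x (tensor_list vs) | x vs. op_ideal P (length vs) x \<and> set vs \<subseteq> vspace B}"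

text \<open>The operation \<open>\<circ>\<^sub>i\<close> of the free algebra, on basis elements.\<close>

fun alg_op :: "'i \<Rightarrow> 'i pbt \<times> 'v list \<Rightarrow> 'i pbt \<times> 'v list \<Rightarrow> 'i pbt \<times> 'v list" where
  "alg_op i (s, us) (t, vs) = (Node i s t, us @ vs)"


section \<open>The Koszul complex\<close>

text \<open>
  The degree \<open>n\<close> component \<open>(P\<^sup>!\<^sub>n)\<^sup>* \<otimes> P(V)\<^sup>\<otimes>\<^sup>n\<close> of the Koszul complex, \<open>n \<ge> 1\<close>, is the quotient of
  \<open>koszul_chains P B n\<close> by \<open>koszul_null P B n\<close>: the kernel of the projection of a tensor product of
  spaces onto the tensor product of quotients of these spaces is spanned by the pure tensors having
  a factor in one of the kernels.
\<close>

type_synonym ('i, 'v, 'k) chain = "'i pbt \<times> ('i pbt \<times> 'v list) list \<Rightarrow>\<^sub>0 'k"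

definition koszul_chains ::
    "('i, 'k::field) quadratic \<Rightarrow> 'v set \<Rightarrow> nat \<Rightarrow> ('i, 'v, 'k) chain set" where
  "koszul_chains P B n = free_vs.span
    {tensor f (tensor_list as) | f as.
      f \<in> dual_component (koszul_dual P) n \<and> length as = n \<and> set as \<subseteq> free_alg (gens P) B}"

definition koszul_null ::
    "('i, 'k::field) quadratic \<Rightarrow> 'v set \<Rightarrow> nat \<Rightarrow> ('i, 'v, 'k) chain set" where
  "koszul_null P B n = free_vs.span
    {tensor f (tensor_list as) | f as.
      f \<in> dual_component (koszul_dual P) n \<and> length as = n \<and> set as \<subseteq> free_alg (gens P) B \<and>
      set as \<inter> null_alg P B \<noteq> {}}"

text \<open>The functional \<open>x \<mapsto> f (x \<circ>\<^sub>k y)\<close> in arity \<open>n\<close>, for \<open>I\<close> finite.\<close>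

definition precomp ::
    "'i set \<Rightarrow> nat \<Rightarrow> nat \<Rightarrow> ('i pbt \<Rightarrow>\<^sub>0 'k::field) \<Rightarrow> ('i pbt \<Rightarrow>\<^sub>0 'k) \<Rightarrow> ('i pbt \<Rightarrow>\<^sub>0 'k)" where
  "precomp I n k y f =
    (\<Sum>s\<in>trees I n.
      Poly_Mapping.single s (eval_dual f (comp_op (Poly_Mapping.single s 1) k y)))"

text \<open>
  The differential is
  \<open>\<delta> (f \<otimes> a\<^sub>0 \<otimes> \<dots>) = (\<Sum>k. \<Sum>i. (-1)^k f(- \<circ>\<^sub>k \<mu>\<^sub>i\<^sup>*) \<otimes> a\<^sub>0 \<otimes> \<dots> \<otimes> \<mu>\<^sub>i(a\<^sub>k, a\<^sub>k\<^sub>+\<^sub>1) \<otimes> \<dots>)\<close>, where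
  \<open>\<mu>\<^sub>i\<close> ranges over the generators and \<open>\<mu>\<^sub>i\<^sup>*\<close> over the dual basis: the coderivation that extends
  the map \<open>(P\<^sup>!\<^sub>2)\<^sup>* \<otimes> P(V)\<^sup>\<otimes>\<^sup>2 \<rightarrow> P(V)\<close> given by the operations of \<open>P(V)\<close>.
\<close>

definition koszul_diff ::
    "('i, 'k::field) quadratic \<Rightarrow> ('i, 'v, 'k) chain \<Rightarrow> ('i, 'v, 'k) chain" where
  "koszul_diff P = lin_ext (\<lambda>(t, ws).
    \<Sum>k<length ws - 1. \<Sum>i\<in>gens P.
      scale ((-1) ^ k)
        (tensor (precomp (gens P) (length ws - 1) k (generator i) (Poly_Mapping.single t 1))
          (Poly_Mapping.single (take k ws @ alg_op i (ws ! k) (ws ! Suc k) # drop (k + 2) ws) 1)))"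

text \<open>Cycles and boundaries of the quotient complex, as sets of representatives.\<close>

definition koszul_cycles ::
    "('i, 'k::field) quadratic \<Rightarrow> 'v set \<Rightarrow> nat \<Rightarrow> ('i, 'v, 'k) chain set" where
  "koszul_cycles P B n = {c \<in> koszul_chains P B n. koszul_diff P c \<in> koszul_null P B (n - 1)}"

definition koszul_boundaries ::
    "('i, 'k::field) quadratic \<Rightarrow> 'v set \<Rightarrow> nat \<Rightarrow> ('i, 'v, 'k) chain set" where
  "koszul_boundaries P B n =
    {koszul_diff P b + e | b e. b \<in> koszul_chains P B (n + 1) \<and> e \<in> koszul_null P B n}"

definition homologous ::
    "('i, 'k::field) quadratic \<Rightarrow> 'v set \<Rightarrow> nat \<Rightarrow> (('i, 'v, 'k) chain \<times> ('i, 'v, 'k) chain) set" where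
  "homologous P B n =
    {(x, y). x \<in> koszul_cycles P B n \<and> y \<in> koszul_cycles P B n \<and>
      x - y \<in> koszul_boundaries P B n}"

definition koszul_homology ::
    "('i, 'k::field) quadratic \<Rightarrow> 'v set \<Rightarrow> nat \<Rightarrow> ('i, 'v, 'k) chain set set" where
  "koszul_homology P B n = koszul_cycles P B n // homologous P B n"

definition koszul_unit :: "('v \<Rightarrow>\<^sub>0 'k::field) \<Rightarrow> ('i, 'v, 'k) chain" where
  "koszul_unit v =
    tensor (Poly_Mapping.single Leaf 1)
      (tensor_list [tensor (Poly_Mapping.single Leaf 1) (tensor_list [v])])"

text \<open>
  Acyclicity: the homology vanishes in degrees \<open>n \<ge> 2\<close>, and the inclusion of \<open>V\<close> as
  \<open>P\<^sub>1 \<otimes> V \<subseteq> P(V)\<close> induces an isomorphism onto the homology in degree 1.  The equality of cycles and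
  boundaries includes that \<open>\<delta> \<circ> \<delta>\<close> vanishes on the quotient complex.
\<close>

definition koszul_acyclic :: "('i, 'k::field) quadratic \<Rightarrow> 'v set \<Rightarrow> bool" where
  "koszul_acyclic P B \<longleftrightarrow>
    (\<forall>n\<ge>2. koszul_cycles P B n = koszul_boundaries P B n) \<and>
    bij_betw (\<lambda>v. homologous P B 1 `` {koszul_unit v}) (vspace B) (koszul_homology P B 1)"

text \<open>
  Quantification over all vector spaces is split into a quantification over the bases inside a type
  \<open>'v\<close> and one over the type \<open>'v\<close>, which HOL only allows at the level of theorems.
\<close>

definition koszul :: "'v itself \<Rightarrow> ('i, 'k::field) quadratic \<Rightarrow> bool" where
  "koszul _ P \<longleftrightarrow> (\<forall>B :: 'v set. koszul_acyclic P B)"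


section \<open>The operads with monomial relations\<close>

definition monomial_operad :: "'i set \<Rightarrow> (Y2 \<times> 'i \<times> 'i) set \<Rightarrow> ('i, 'k::field) quadratic" where
  "monomial_operad I Z = \<lparr>gens = I, rels = (\<lambda>z. Poly_Mapping.single (quad_tree z) 1) ` Z\<rparr>"

end

theory Submission
  imports Defs
begin

text \<open>
  A monomial quadratic operad has an explicit basis, and so has its Koszul complex.  To a tree \<open>t\<close>
  belongs the set \<open>edges t\<close> of its quadratic subtrees, one for each internal edge.  With relations
  \<open>Z\<close>, the trees without an edge in \<open>Z\<close> form a basis of the operad; the Koszul dual is the monomial
  operad whose relations are the complement of \<open>Z\<close>, so that the dual of its arity \<open>n\<close> component has
  as a basis the trees with \<open>n\<close> leaves and all edges in \<open>Z\<close>.  Since the theorem is symmetric in \<open>X\<close>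
  and \<open>Z\<close>, only one of the two operads needs to be treated.

  Modulo the null chains, a basis of the Koszul complex therefore consists of the cells \<open>(t, ws)\<close>,
  where \<open>t\<close> has all its edges in \<open>Z\<close> and the words \<open>ws\<close> that are attached to the leaves of \<open>t\<close> have
  trees without edges in \<open>Z\<close>.  The differential removes a terminal vertex (a cherry) of \<open>t\<close> and moves
  it to the bottom: the words on its two leaves are merged by the corresponding operation, which gives
  zero if this creates an edge in \<open>Z\<close>.  Grafting \<open>ws\<close> on \<open>t\<close> gives a total tree that does not change;
  its movable vertices are pairwise incomparable, each can be moved independently of the others, and
  the summand belonging to a total tree is, up to signs and a shift of the degree, a tensor power of
  the acyclic complex with two basis elements and a bijection between them.  It remains to see that
  some vertex is movable unless the total tree is a leaf.  If \<open>t\<close> is a leaf, the root vertex of the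
  only word can be moved up.  Otherwise \<open>t\<close> has a cherry; if it cannot be moved down, then one of the
  two words on it has a root vertex that is linked to the cherry by an edge in \<open>Z\<close>, and this vertex
  can be moved up into \<open>t\<close>.

  The tensor power itself is avoided.  The moves at the \<open>k\<close>-th leaf form a partial bijection between
  cells, and the locale \<open>matchings\<close> lists the commutation rules that these partial bijections satisfy.
  They suffice for \<open>bd_bd\<close>, that the boundary squares to zero, and for \<open>homotopy\<close>: moving the leftmost
  movable vertex up, with a sign, is a contracting homotopy on the cells that have a movable vertex.
  The rules are verified for cells in the locale \<open>cell_matching\<close>; they rest on the fact that two
  different cherries of a tree are disjoint (\<open>two_cherries\<close>) and on the description of the edges of a
  grafted tree (\<open>edges_graft\<close>).
\<close>

section \<open>Linear algebra in free vector spaces\<close>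

abbreviation basis :: "'a \<Rightarrow> ('a \<Rightarrow>\<^sub>0 'k::field)" where
  "basis a \<equiv> Poly_Mapping.single a 1"

lemma scale_single [simp]: "scale c (Poly_Mapping.single a d) = Poly_Mapping.single a (c * d)"
  by (rule poly_mapping_eqI) (simp add: lookup_single when_def)

lemma keys_scale_subset: "Poly_Mapping.keys (scale c x) \<subseteq> Poly_Mapping.keys x"
  by (auto simp: in_keys_iff)

lemma subspace_vspace: "free_vs.subspace (vspace A :: ('a \<Rightarrow>\<^sub>0 'b::field) set)"
proof -
  have "Poly_Mapping.keys (x + y) \<subseteq> A" if "Poly_Mapping.keys x \<subseteq> A" "Poly_Mapping.keys y \<subseteq> A"
    for x y :: "'a \<Rightarrow>\<^sub>0 'b"
    using Poly_Mapping.keys_add[of x y] that by blast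
  moreover have "Poly_Mapping.keys (scale c x) \<subseteq> A" if "Poly_Mapping.keys x \<subseteq> A"
    for c and x :: "'a \<Rightarrow>\<^sub>0 'b"
    using keys_scale_subset[of c x] that by blast
  ultimately show ?thesis
    by (simp add: free_vs.subspace_def vspace_def)
qed

lemmas vspace_0 [simp, intro] = free_vs.subspace_0[OF subspace_vspace]
lemmas vspace_add [intro] = free_vs.subspace_add[OF subspace_vspace]
lemmas vspace_diff [intro] = free_vs.subspace_diff[OF subspace_vspace]
lemmas vspace_scale [intro] = free_vs.subspace_scale[OF subspace_vspace]
lemmas vspace_sum = free_vs.subspace_sum[OF subspace_vspace]

lemma vspace_single [simp]: "a \<in> A \<Longrightarrow> Poly_Mapping.single a c \<in> vspace A"
  by (auto simp: vspace_def)

lemma vspace_mono: "A \<subseteq> B \<Longrightarrow> vspace A \<subseteq> vspace B"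
  by (auto simp: vspace_def)

lemma vspaceD: "x \<in> vspace A \<Longrightarrow> a \<in> Poly_Mapping.keys x \<Longrightarrow> a \<in> A"
  by (auto simp: vspace_def)

lemma vspace_disjoint:
  assumes "x \<in> vspace A" "x \<in> vspace A'" "A \<inter> A' = {}"
  shows "x = 0"
proof -
  have "Poly_Mapping.keys x = {}"
    using assms unfolding vspace_def by blast
  then show ?thesis
    by simp
qed

lemma lin_ext_basis: "lin_ext basis x = x"
proof (rule poly_mapping_eqI)
  fix a
  have "Poly_Mapping.lookup (lin_ext basis x) a =
      (\<Sum>b\<in>Poly_Mapping.keys x. if b = a then Poly_Mapping.lookup x b else 0)"
    by (auto simp: lin_ext_def lookup_sum lookup_single when_def intro!: sum.cong)
  then show "Poly_Mapping.lookup (lin_ext basis x) a = Poly_Mapping.lookup x a"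
    by (simp add: in_keys_iff)
qed

lemma lin_ext_superset:
  "finite A \<Longrightarrow> Poly_Mapping.keys x \<subseteq> A \<Longrightarrow>
    lin_ext f x = (\<Sum>a\<in>A. scale (Poly_Mapping.lookup x a) (f a))"
  unfolding lin_ext_def by (rule sum.mono_neutral_left) (auto simp: in_keys_iff)

lemma lin_ext_add: "lin_ext f (x + y) = lin_ext f x + lin_ext f y"
proof -
  let ?A = "Poly_Mapping.keys x \<union> Poly_Mapping.keys y"
  have "Poly_Mapping.keys (x + y) \<subseteq> ?A"
    by (rule Poly_Mapping.keys_add)
  then show ?thesis
    by (simp add: lin_ext_superset[of ?A] lookup_add free_vs.scale_left_distrib sum.distrib)
qed

lemma lin_ext_scale: "lin_ext f (scale c x) = scale c (lin_ext f x)"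
  using keys_scale_subset[of c x]
  by (simp add: lin_ext_superset[of "Poly_Mapping.keys x"] free_vs.scale_sum_right)

lemma lin_ext_0 [simp]: "lin_ext f 0 = 0"
  by (simp add: lin_ext_def)

lemma lin_ext_diff: "lin_ext f (x - y) = lin_ext f x - lin_ext f y"
  using lin_ext_add[of f "x - y" y] by (simp add: algebra_simps)

lemma lin_ext_sum: "lin_ext f (sum g A) = (\<Sum>a\<in>A. lin_ext f (g a))"
  by (induction A rule: infinite_finite_induct) (auto simp: lin_ext_add)

lemma lin_ext_single [simp]: "lin_ext f (Poly_Mapping.single a c) = scale c (f a)"
  by (simp add: lin_ext_superset[of "{a}"])

lemma lin_ext_lin_ext: "lin_ext f (lin_ext g x) = lin_ext (\<lambda>a. lin_ext f (g a)) x"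
  by (simp add: lin_ext_def[of g] lin_ext_def[of "\<lambda>a. lin_ext f (g a)"] lin_ext_sum lin_ext_scale)

lemma lin_ext_in_vspace:
  "x \<in> vspace A \<Longrightarrow> (\<And>a. a \<in> A \<Longrightarrow> f a \<in> vspace B) \<Longrightarrow> lin_ext f x \<in> vspace B"
  unfolding lin_ext_def by (intro vspace_sum vspace_scale) (auto dest: vspaceD)

lemma lin_ext_diff_fun: "lin_ext (\<lambda>a. f a - g a) x = lin_ext f x - lin_ext g x"
  by (simp add: lin_ext_def free_vs.scale_right_diff_distrib sum_subtractf)

text \<open>
  All spaces of the Koszul complex are given as spans of pure tensors; this identifies them with the
  spaces of the elements supported on a set of basis elements.
\<close>

lemma span_eq_vspace:
  assumes "S \<subseteq> vspace A" and "\<And>a. a \<in> A \<Longrightarrow> basis a \<in> S"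
  shows "free_vs.span S = vspace A"
proof
  show "free_vs.span S \<subseteq> vspace A"
    using assms(1) subspace_vspace by (rule free_vs.span_minimal)
  show "vspace A \<subseteq> free_vs.span S"
  proof
    fix x :: "'a \<Rightarrow>\<^sub>0 'b" assume "x \<in> vspace A"
    then have "lin_ext basis x \<in> free_vs.span S"
      unfolding lin_ext_def
      by (intro free_vs.span_sum free_vs.span_scale free_vs.span_base assms(2)) (auto dest: vspaceD)
    then show "x \<in> free_vs.span S"
      by (simp only: lin_ext_basis)
  qed
qed

lemma bilin_ext_single [simp]:
  "bilin_ext f (Poly_Mapping.single a c) (Poly_Mapping.single b d) =
    Poly_Mapping.single (f a b) (c * d)"
  by (cases "c = 0"; cases "d = 0") (auto simp: bilin_ext_def)

lemma bilin_ext_in_vspace: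
  assumes "x \<in> vspace A" "y \<in> vspace B" "\<And>a b. a \<in> A \<Longrightarrow> b \<in> B \<Longrightarrow> f a b \<in> C"
  shows "bilin_ext f x y \<in> vspace C"
  unfolding bilin_ext_def using assms
  by (intro vspace_sum vspace_single) (auto dest: vspaceD)

lemma lin_ext_0_fun [simp]: "lin_ext (\<lambda>_. 0) x = 0"
  by (simp add: lin_ext_def)

lemma bilin_ext_0_left [simp]: "bilin_ext f 0 y = 0"
  by (simp add: bilin_ext_def)

lemma bilin_ext_basis_right: "bilin_ext f x (basis b) = lin_ext (\<lambda>a. basis (f a b)) x"
  by (simp add: bilin_ext_def lin_ext_def)

lemma bilin_ext_basis_left: "bilin_ext f (basis a) y = lin_ext (\<lambda>b. basis (f a b)) y"
  by (simp add: bilin_ext_def lin_ext_def)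

lemma tensor_list_basis: "tensor_list (map basis as) = basis as"
  by (induction as) auto

lemma tensor_list_in_vspace:
  "list_all2 (\<lambda>x A. x \<in> vspace A) xs As \<Longrightarrow> tensor_list xs \<in> vspace {as. list_all2 (\<in>) as As}"
  by (induction rule: list_all2_induct) (auto intro: bilin_ext_in_vspace)

section \<open>Graded sets with partial matchings\<close>

text \<open>
  The basis element of a partial function value; an undefined value gives the zero vector.
\<close>

definition osingle :: "'a option \<Rightarrow> ('a \<Rightarrow>\<^sub>0 'k::field)" where
  "osingle = (\<lambda>None \<Rightarrow> 0 | Some a \<Rightarrow> basis a)"

lemma osingle_simps [simp]: "osingle None = 0" "osingle (Some a) = basis a"
  by (auto simp: osingle_def)

lemma osingle_in_vspace: "(\<And>y. p = Some y \<Longrightarrow> y \<in> A) \<Longrightarrow> osingle p \<in> vspace A"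
  by (cases p) auto

abbreviation sgn_pow :: "nat \<Rightarrow> 'k::field" where
  "sgn_pow k \<equiv> (-1) ^ k"

lemma sgn_pow_cancel [simp]: "sgn_pow m * (c * sgn_pow m) = (c :: 'k::field)"
proof -
  have "sgn_pow m * sgn_pow m = (1 :: 'k)"
    by (simp flip: power_mult_distrib)
  then show ?thesis
    by (metis mult.assoc mult.commute mult_1_right)
qed

text \<open>
  A graded set with partial bijections \<open>dn k\<close>, which lower the degree by one, and their inverses
  \<open>up k\<close>.  Moves at distant positions commute, with the index shift of the simplicial identities.
  Moves at overlapping positions exclude each other: they cannot be composed, and moves down at two
  adjacent positions are never both defined.
\<close>

locale matchings =
  fixes deg :: "'a \<Rightarrow> nat" and dn up :: "nat \<Rightarrow> 'a \<Rightarrow> 'a option"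
  assumes up_iff: "up k y = Some x \<longleftrightarrow> dn k x = Some y"
    and deg_dn: "dn k x = Some y \<Longrightarrow> deg x = Suc (deg y) \<and> k < deg y"
    and no_nesting: "dn k x = Some y \<Longrightarrow> dn l y = Some z \<Longrightarrow> l \<noteq> k \<and> Suc l \<noteq> k"
    and swap_left: "dn k x = Some y \<Longrightarrow> dn l y = Some z \<Longrightarrow> Suc l < k \<Longrightarrow>
      \<exists>y'. dn l x = Some y' \<and> dn (k - 1) y' = Some z"
    and swap_right: "dn k x = Some y \<Longrightarrow> dn l y = Some z \<Longrightarrow> k < l \<Longrightarrow>
      \<exists>y'. dn (Suc l) x = Some y' \<and> dn k y' = Some z"
    and confluence: "dn k x = Some y \<Longrightarrow> dn l x = Some y' \<Longrightarrow> l < k \<Longrightarrow>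
      Suc l < k \<and> (\<exists>z. dn l y = Some z \<and> dn (k - 1) y' = Some z)"
    and coconfluence: "dn k x = Some y \<Longrightarrow> up l y \<noteq> None \<Longrightarrow> l < k \<Longrightarrow> up l x \<noteq> None"
begin

text \<open>
  The boundary, in analogy with the alternating sum of the faces of a simplex.
\<close>

definition bd :: "'a \<Rightarrow> ('a \<Rightarrow>\<^sub>0 'k::field)" where
  "bd x = (\<Sum>k<deg x - 1. scale (sgn_pow k) (osingle (dn k x)))"

text \<open>
  The positions at which an element can be moved, in one of the two directions.  By \<open>no_nesting\<close> never
  both directions are possible at the same position.
\<close>

definition active :: "'a \<Rightarrow> nat \<Rightarrow> bool" where
  "active x k \<longleftrightarrow> dn k x \<noteq> None \<or> up k x \<noteq> None"

text \<open>
  The contracting homotopy: it moves up at the first active position.  It vanishes if there is no such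
  position, or if the move at the first one is a move down.
\<close>

definition ht :: "'a \<Rightarrow> ('a \<Rightarrow>\<^sub>0 'k::field)" where
  "ht x = (if \<exists>k. active x k
    then let m = (LEAST k. active x k) in scale (sgn_pow m) (osingle (up m x)) else 0)"

lemma ht_eq:
  assumes "active x m" "\<And>l. l < m \<Longrightarrow> \<not> active x l"
  shows "ht x = scale (sgn_pow m) (osingle (up m x))"
proof -
  have "(LEAST k. active x k) = m"
    using assms by (intro Least_equality) (auto simp: not_less[symmetric])
  then show ?thesis
    using assms(1) by (auto simp: ht_def Let_def)
qed

lemma bd_bd: "lin_ext bd (bd x :: 'a \<Rightarrow>\<^sub>0 'k::field) = 0"
proof -
  define n where "n = deg x - 1"
  define a :: "nat \<Rightarrow> nat \<Rightarrow> ('a \<Rightarrow>\<^sub>0 'k)" where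
    "a k l = osingle (Option.bind (dn k x) (dn l))" for k l
  have zero: "a k l = 0" if "l = k \<or> Suc l = k" for k l
    using that no_nesting unfolding a_def
    by (metis bind_eq_Some_conv osingle_simps(1) option.exhaust)
  have sw: "a k l = a l (k - 1)" if "Suc l < k" for k l
  proof -
    have "Option.bind (dn k x) (dn l) = Some z \<longleftrightarrow> Option.bind (dn l x) (dn (k - 1)) = Some z" for z
    proof
      assume "Option.bind (dn k x) (dn l) = Some z"
      then show "Option.bind (dn l x) (dn (k - 1)) = Some z"
        using swap_left[OF _ _ that] by (auto simp: bind_eq_Some_conv)
    next
      assume "Option.bind (dn l x) (dn (k - 1)) = Some z"
      then obtain y where y: "dn l x = Some y" "dn (k - 1) y = Some z"
        by (auto simp: bind_eq_Some_conv)
      moreover have "l < k - 1" "Suc (k - 1) = k"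
        using that by auto
      ultimately show "Option.bind (dn k x) (dn l) = Some z"
        using swap_right[of l x y "k - 1" z] by (auto simp: bind_eq_Some_conv)
    qed
    then show ?thesis
      unfolding a_def by (metis option.exhaust)
  qed
  have inner: "lin_ext bd (osingle (dn k x) :: 'a \<Rightarrow>\<^sub>0 'k) = (\<Sum>l<n - 1. scale (sgn_pow l) (a k l))" for k
    using deg_dn[of k x] by (cases "dn k x") (auto simp: a_def bd_def n_def)
  \<comment> \<open>The double sum cancels in pairs: the terms with \<open>l + 1 < k\<close> against those with \<open>k < l\<close>.\<close>
  have "lin_ext bd (bd x :: 'a \<Rightarrow>\<^sub>0 'k) =
      (\<Sum>k<n. \<Sum>l<n - 1. scale (sgn_pow (k + l)) (a k l))"
    by (simp only: bd_def[of x] lin_ext_sum lin_ext_scale inner free_vs.scale_sum_right power_add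
        free_vs.scale_scale flip: n_def)
  also have "\<dots> = (\<Sum>(k, l)\<in>{..<n} \<times> {..<n - 1}. scale (sgn_pow (k + l)) (a k l))"
    by (simp add: sum.cartesian_product)
  also have "\<dots> = (\<Sum>(k, l)\<in>{(k, l). k < n \<and> Suc l < k} \<union> {(k, l). l < n - 1 \<and> k < l}.
      scale (sgn_pow (k + l)) (a k l))"
  proof (rule sum.mono_neutral_right)
    show "\<forall>p\<in>{..<n} \<times> {..<n - 1} - ({(k, l). k < n \<and> Suc l < k} \<union> {(k, l). l < n - 1 \<and> k < l}).
        (case p of (k, l) \<Rightarrow> scale (sgn_pow (k + l)) (a k l)) = 0"
    proof (rule ballI)
      fix p assume p: "p \<in> {..<n} \<times> {..<n - 1} - ({(k, l). k < n \<and> Suc l < k} \<union> {(k, l). l < n - 1 \<and> k < l})"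
      obtain k l where "p = (k, l)" by (cases p)
      moreover from this p have "l = k \<or> Suc l = k"
        by auto
      ultimately show "(case p of (k, l) \<Rightarrow> scale (sgn_pow (k + l)) (a k l)) = 0"
        by (simp add: zero)
    qed
  qed auto
  also have "\<dots> = (\<Sum>(k, l)\<in>{(k, l). k < n \<and> Suc l < k}. scale (sgn_pow (k + l)) (a k l))
      + (\<Sum>(k, l)\<in>{(k, l). l < n - 1 \<and> k < l}. scale (sgn_pow (k + l)) (a k l))"
  proof (rule sum.union_disjoint)
    show "finite {(k, l). k < n \<and> Suc l < k}"
      by (rule finite_subset[of _ "{..<n} \<times> {..<n}"]) auto
    show "finite {(k, l). l < n - 1 \<and> k < l}"
      by (rule finite_subset[of _ "{..<n} \<times> {..<n}"]) auto
  qed auto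
  also have "(\<Sum>(k, l)\<in>{(k, l). l < n - 1 \<and> k < l}. scale (sgn_pow (k + l)) (a k l)) =
      (\<Sum>(k, l)\<in>{(k, l). k < n \<and> Suc l < k}. - scale (sgn_pow (k + l)) (a k l))"
  proof (rule sum.reindex_bij_witness[of _ "\<lambda>(k, l). (l, k - 1)" "\<lambda>(k, l). (Suc l, k)"], goal_cases)
    case (5 p)
    then obtain k l where "p = (k, l)" "k < l"
      by auto
    then show ?case
      using sw[of k "Suc l"] by (simp add: add.commute)
  qed auto
  finally show ?thesis
    by (simp add: sum_negf case_prod_unfold)
qed

text \<open>
  Write \<open>m\<close> for the first active position of \<open>x\<close>.  A move down at a position after \<open>m\<close> leaves \<open>m\<close> the
  first active position, in the same direction.  If \<open>x\<close> can be moved up at \<open>m\<close>, the terms of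
  \<open>bd (ht x)\<close> other than \<open>x\<close> therefore cancel with \<open>ht (bd x)\<close>; if it can be moved down at \<open>m\<close>, then
  \<open>ht x = 0\<close>, and in \<open>ht (bd x)\<close> only the term that moves down and up at \<open>m\<close> survives.
\<close>

lemma homotopy:
  assumes "active x k"
  shows "lin_ext bd (ht x) + lin_ext ht (bd x) = (basis x :: 'a \<Rightarrow>\<^sub>0 'k::field)"
proof -
  define m where "m = (LEAST k. active x k)"
  define n where "n = deg x - 1"
  define d where "d j = (lin_ext ht (osingle (dn j x)) :: 'a \<Rightarrow>\<^sub>0 'k)" for j
  have act: "active x m"
    using assms unfolding m_def by (rule LeastI)
  have min: "dn l x = None" "up l x = None" if "l < m" for l
    using not_less_Least[of l "active x"] that unfolding m_def active_def by auto
  have ht_bd: "lin_ext ht (bd x) = (\<Sum>j<n. scale (sgn_pow j) (d j))"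
    by (simp only: bd_def[of x] lin_ext_sum lin_ext_scale d_def n_def)
  have below: "\<not> active y l" if "dn j x = Some y" "m \<le> j" "l < m" for j y l
  proof -
    have "up l y = None"
      using coconfluence[OF that(1), of l] min[OF that(3)] that by force
    moreover have "dn l y = None"
    proof (rule ccontr)
      assume "dn l y \<noteq> None"
      then obtain z where z: "dn l y = Some z" by auto
      have "Suc l < j"
        using no_nesting[OF that(1) z] that by auto
      then show False
        using swap_left[OF that(1) z] min[OF that(3)] by auto
    qed
    ultimately show ?thesis
      by (simp add: active_def)
  qed
  show ?thesis
  proof (cases "up m x")
    case (Some x')
    then have x': "dn m x' = Some x"
      by (simp add: up_iff)
    have "dn m x = None"
      using no_nesting[OF x', of m] by force
    have deg': "deg x' - 1 = Suc n" "m < Suc n"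
      using deg_dn[OF x'] by (auto simp: n_def)
    define e where "e j = (scale (sgn_pow j) (osingle (dn j x')) :: 'a \<Rightarrow>\<^sub>0 'k)" for j
    \<comment> \<open>The summands of \<open>bd x'\<close> before, at and after the position \<open>m\<close>.\<close>
    have e_before: "e j = 0" if "j < m" for j
    proof (cases "dn j x'")
      case (Some y)
      then show ?thesis
        using confluence[OF x' Some that] min[OF that] by auto
    qed (simp add: e_def)
    have e_m: "e m = scale (sgn_pow m) (basis x)"
      by (simp add: e_def x')
    have e_after: "e (Suc j) = - scale (sgn_pow m) (scale (sgn_pow j) (d j))" if "m \<le> j" for j
    proof (cases "dn j x")
      case None
      have "dn (Suc j) x' = None"
        using confluence[OF _ x', of "Suc j"] that None by (cases "dn (Suc j) x'") auto
      then show ?thesis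
        using None by (simp add: e_def d_def)
    next
      case (Some y)
      then have "m < j"
        using that \<open>dn m x = None\<close> by (cases "j = m") auto
      then obtain y' where y': "dn (Suc j) x' = Some y'" "dn m y' = Some y"
        using swap_right[OF x' Some] by auto
      then have "up m y = Some y'"
        by (simp add: up_iff)
      moreover from this have "ht y = (scale (sgn_pow m) (osingle (up m y)) :: 'a \<Rightarrow>\<^sub>0 'k)"
        using below[OF Some that] by (intro ht_eq) (auto simp: active_def)
      ultimately show ?thesis
        using Some y' by (simp add: e_def d_def mult.commute flip: single_uminus)
    qed
    have d_before: "d j = 0" if "j < m" for j
      using min[OF that] by (simp add: d_def)
    have "ht x = (scale (sgn_pow m) (basis x') :: 'a \<Rightarrow>\<^sub>0 'k)"
      using ht_eq[OF act] min by (simp add: active_def Some)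
    then have "lin_ext bd (ht x) = (scale (sgn_pow m) (bd x') :: 'a \<Rightarrow>\<^sub>0 'k)"
      by (simp only: lin_ext_scale lin_ext_single free_vs.scale_one)
    also have "bd x' = (\<Sum>j<Suc n. e j)"
      by (simp only: bd_def e_def deg')
    also have "\<dots> = (\<Sum>j\<in>{m..<Suc n}. e j)"
      using e_before by (intro sum.mono_neutral_right) auto
    also have "\<dots> = e m + (\<Sum>j\<in>{m..<n}. e (Suc j))"
      using deg' by (simp add: sum.atLeast_Suc_lessThan sum.shift_bounds_Suc_ivl
          del: sum.op_ivl_Suc)
    also have "(\<Sum>j\<in>{m..<n}. e (Suc j)) = - scale (sgn_pow m) (\<Sum>j\<in>{m..<n}. scale (sgn_pow j) (d j))"
      using e_after by (simp add: free_vs.scale_sum_right sum_negf)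
    also have "(\<Sum>j\<in>{m..<n}. scale (sgn_pow j) (d j)) = lin_ext ht (bd x)"
      unfolding ht_bd using d_before by (intro sum.mono_neutral_left) auto
    also have "scale (sgn_pow m) (e m + - scale (sgn_pow m) (lin_ext ht (bd x))) =
        basis x - lin_ext ht (bd x)"
      by (simp add: e_m free_vs.scale_right_diff_distrib flip: power_mult_distrib)
    finally show ?thesis
      by (simp only: diff_add_cancel)
  next
    case None
    then obtain y where y: "dn m x = Some y"
      using act by (auto simp: active_def)
    have "ht x = (0 :: 'a \<Rightarrow>\<^sub>0 'k)"
      using ht_eq[OF act] min by (simp add: active_def None)
    have "ht y = (scale (sgn_pow m) (basis x) :: 'a \<Rightarrow>\<^sub>0 'k)"
      using ht_eq[of y m] below[OF y] y by (simp add: active_def flip: up_iff)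
    then have d_m: "d m = scale (sgn_pow m) (basis x)"
      by (simp add: d_def y)
    have d_other: "d j = 0" if "j \<noteq> m" for j
    proof (cases "dn j x")
      case None
      then show ?thesis by (simp add: d_def)
    next
      case (Some z)
      then have "m < j"
        using min that by (metis linorder_neqE_nat option.distinct(1))
      then have "dn m z \<noteq> None"
        using confluence[OF Some y] by auto
      moreover have "up m z = None"
        using coconfluence[OF Some _ \<open>m < j\<close>] \<open>up m x = None\<close> by blast
      ultimately have "ht z = (0 :: 'a \<Rightarrow>\<^sub>0 'k)"
        using ht_eq[of z m] below[OF Some] \<open>m < j\<close> by (simp add: active_def)
      then show ?thesis
        by (simp add: d_def Some)
    qed
    have "lin_ext ht (bd x) = (\<Sum>j\<in>{m}. scale (sgn_pow j) (d j))"
      unfolding ht_bd using d_other deg_dn[OF y]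
      by (intro sum.mono_neutral_right) (auto simp: n_def)
    also have "\<dots> = basis x"
      by (simp add: d_m flip: power_mult_distrib)
    finally show ?thesis
      using \<open>ht x = 0\<close> by simp
  qed
qed

end

section \<open>Monomial ideals of the free operad\<close>

text \<open>
  The internal edge that arises when the tree is attached below a given parent vertex, as a set with
  at most one element.  A parent is given by its label and by the side of the child: \<open>TR\<close> for a left
  child and \<open>TL\<close> for a right child, according to the shape of the resulting quadratic tree.
\<close>

fun link :: "(Y2 \<times> 'i) option \<Rightarrow> 'i pbt \<Rightarrow> (Y2 \<times> 'i \<times> 'i) set" where
  "link (Some (TR, p)) (Node j l r) = {(TR, j, p)}"
| "link (Some (TL, p)) (Node j l r) = {(TL, p, j)}"
| "link _ _ = {}"

text \<open>
  The quadratic subtrees of a tree, one for each internal edge, as decorated trees \<open>(T; i, j)\<close>.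
\<close>

fun edges :: "'i pbt \<Rightarrow> (Y2 \<times> 'i \<times> 'i) set" where
  "edges Leaf = {}"
| "edges (Node i l r) = link (Some (TR, i)) l \<union> edges l \<union> (link (Some (TL, i)) r \<union> edges r)"

text \<open>
  The parents of the leaves from left to right; \<open>p\<close> is the parent of the root, \<open>None\<close> if there is none.
\<close>

fun parents :: "(Y2 \<times> 'i) option \<Rightarrow> 'i pbt \<Rightarrow> (Y2 \<times> 'i) option list" where
  "parents p Leaf = [p]"
| "parents p (Node i l r) = parents (Some (TR, i)) l @ parents (Some (TL, i)) r"

lemma leaves_pos [simp]: "0 < leaves t"
  by (induction t) auto

lemma length_parents [simp]: "length (parents p t) = leaves t"
  by (induction t arbitrary: p) auto

lemma leaves_graft [simp]: "k < leaves s \<Longrightarrow> leaves (graft s k t) = leaves s + leaves t - 1"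
proof (induction s arbitrary: k)
  case (Node i l r)
  then show ?case
    using leaves_pos[of l] leaves_pos[of r] leaves_pos[of t] by auto
qed auto

lemma labels_graft [simp]: "k < leaves s \<Longrightarrow> labels (graft s k t) = labels s \<union> labels t"
  by (induction s arbitrary: k) auto

lemma link_Leaf [simp]: "link p Leaf = {}"
  by (cases "(p, Leaf :: 'a pbt)" rule: link.cases) auto

lemma link_None [simp]: "link None t = {}"
  by (cases t) auto

lemma link_Node_cong: "link p (Node i l r) = link p (Node i l' r')"
proof (cases p)
  case (Some q)
  then show ?thesis by (cases "(p, Node i l r)" rule: link.cases) auto
qed simp

lemma link_subset: "link (Some (T, i)) t \<subseteq> UNIV \<times> insert i (labels t) \<times> insert i (labels t)"
  by (cases "(Some (T, i), t)" rule: link.cases) auto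

lemma edges_subset: "edges t \<subseteq> UNIV \<times> labels t \<times> labels t"
proof (induction t)
  case (Node i l r)
  then show ?case
    using link_subset[of TR i l] link_subset[of TL i r] by simp blast
qed simp

lemma link_edges_graft:
  "k < leaves s \<Longrightarrow> link p (graft s k t) \<union> edges (graft s k t) =
    link p s \<union> edges s \<union> (link (parents p s ! k) t \<union> edges t)"
proof (induction s arbitrary: p k)
  case (Node i l r)
  show ?case
  proof (cases "k < leaves l")
    case True
    then show ?thesis
      using Node.IH(1)[OF True, of "Some (TR, i)"] link_Node_cong[of p i l r "graft l k t" r]
      by (auto simp: nth_append)
  next
    case False
    then have "k - leaves l < leaves r"
      using Node.prems by auto
    then show ?thesis
      using False Node.IH(2)[of "k - leaves l" "Some (TL, i)"]
        link_Node_cong[of p i l r l "graft r (k - leaves l) t"]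
      by (auto simp: nth_append)
  qed
qed simp

lemma edges_graft:
  "k < leaves s \<Longrightarrow> edges (graft s k t) = edges s \<union> (link (parents None s ! k) t \<union> edges t)"
  using link_edges_graft[of k s None t] by simp

lemma trees_3: "trees I 3 = quad_tree ` (UNIV \<times> I \<times> I)"
proof
  show "trees I 3 \<subseteq> quad_tree ` (UNIV \<times> I \<times> I)"
  proof
    fix t assume "t \<in> trees I 3"
    then have t: "labels t \<subseteq> I" "leaves t = 3"
      by (auto simp: trees_def)
    have leaf: "s = Leaf" if "leaves s = 1" for s :: "'a pbt"
    proof (cases s)
      case (Node j a b)
      then show ?thesis
        using that leaves_pos[of a] leaves_pos[of b] by simp
    qed
    have cherry: "\<exists>j. s = Node j Leaf Leaf" if "leaves s = 2" for s :: "'a pbt"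
    proof (cases s)
      case (Node j a b)
      then have "leaves a + leaves b = 2"
        using that by simp
      then have "leaves a = 1" "leaves b = 1"
        using leaves_pos[of a] leaves_pos[of b] by linarith+
      then show ?thesis
        using Node leaf by auto
    qed (use that in auto)
    obtain i l r where Node: "t = Node i l r"
      using t by (cases t) auto
    then have "leaves l + leaves r = 3"
      using t by simp
    then consider "leaves l = 1" "leaves r = 2" | "leaves l = 2" "leaves r = 1"
      using leaves_pos[of l] leaves_pos[of r] by linarith
    then show "t \<in> quad_tree ` (UNIV \<times> I \<times> I)"
    proof cases
      case 1
      then obtain j where j: "t = Node i Leaf (Node j Leaf Leaf)"
        using leaf[of l] cherry[of r] Node by auto
      then show ?thesis
        using t by (intro image_eqI[of _ _ "(TL, i, j)"]) auto
    next
      case 2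
      then obtain j where j: "t = Node i (Node j Leaf Leaf) Leaf"
        using leaf[of r] cherry[of l] Node by auto
      then show ?thesis
        using t by (intro image_eqI[of _ _ "(TR, j, i)"]) auto
    qed
  qed
  show "quad_tree ` (UNIV \<times> I \<times> I) \<subseteq> trees I 3"
  proof clarify
    fix T i j assume "i \<in> I" "j \<in> I"
    then show "quad_tree (T, i, j) \<in> trees I 3"
      by (cases T) (auto simp: trees_def)
  qed
qed

lemma edges_quad_tree [simp]: "edges (quad_tree z) = {z}"
  by (cases z rule: quad_tree.cases) auto

lemma inj_quad_tree: "inj quad_tree"
  by (rule injI) (metis edges_quad_tree singleton_inject)

lemma free_op_eq_vspace: "free_op I n = vspace (trees I n)"
  by (auto simp: free_op_def vspace_def)

text \<open>
  The trees in the ideal generated by the monomials \<open>S\<close>.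
\<close>

definition bad_trees :: "'i set \<Rightarrow> (Y2 \<times> 'i \<times> 'i) set \<Rightarrow> nat \<Rightarrow> 'i pbt set" where
  "bad_trees I S n = {t \<in> trees I n. edges t \<inter> S \<noteq> {}}"

text \<open>
  A presentation whose relators span the space with the basis \<open>S\<close>.  Both the monomial operads and, by
  \<open>monomial_presentation_koszul_dual\<close>, their Koszul duals are of this form; for the latter the set of
  relators is the whole subspace.
\<close>

locale monomial_presentation =
  fixes P :: "('i, 'k::field) quadratic" and I :: "'i set" and S :: "(Y2 \<times> 'i \<times> 'i) set"
  assumes gens: "gens P = I"
    and S_subset: "S \<subseteq> UNIV \<times> I \<times> I"
    and rels_subset: "rels P \<subseteq> vspace (quad_tree ` S)"
    and rels_basis: "z \<in> S \<Longrightarrow> basis (quad_tree z) \<in> rels P"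
begin

lemma op_ideal_imp: "op_ideal P n x \<Longrightarrow> x \<in> vspace (bad_trees I S n)"
proof (induction rule: op_ideal.induct)
  case (rel r)
  have "quad_tree ` S \<subseteq> bad_trees I S 3"
    using S_subset trees_3[of I] by (auto simp: bad_trees_def)
  then show ?case
    using rel rels_subset vspace_mono by blast
next
  case (comp_left m x y n k)
  then show ?case
    unfolding comp_op_def gens free_op_eq_vspace
    by (elim bilin_ext_in_vspace) (auto simp: bad_trees_def trees_def edges_graft)
next
  case (comp_right x m n y k)
  then show ?case
    unfolding comp_op_def gens free_op_eq_vspace
    by (elim bilin_ext_in_vspace) (auto simp: bad_trees_def trees_def edges_graft)
qed auto

lemma op_ideal_graft_left:
  assumes "op_ideal P (leaves s) (basis s)" "k < leaves s" "labels t \<subseteq> I"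
  shows "op_ideal P (leaves (graft s k t)) (basis (graft s k t))"
proof -
  have "basis t \<in> free_op (gens P) (leaves t)"
    using assms(3) by (simp add: gens free_op_eq_vspace trees_def)
  from op_ideal.comp_left[OF assms(1) this assms(2)] show ?thesis
    using assms(2) by (simp add: comp_op_def)
qed

lemma op_ideal_graft_right:
  assumes "op_ideal P (leaves t) (basis t)" "k < leaves s" "labels s \<subseteq> I"
  shows "op_ideal P (leaves (graft s k t)) (basis (graft s k t))"
proof -
  have "basis s \<in> free_op (gens P) (leaves s)"
    using assms(3) by (simp add: gens free_op_eq_vspace trees_def)
  from op_ideal.comp_right[OF this assms(1,2)] show ?thesis
    using assms(2) by (simp add: comp_op_def)
qed

text \<open>
  The three trees are grafted from right to left, so that the positions of the remaining leaves do not
  shift.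
\<close>

lemma op_ideal_quad_tree:
  assumes "z \<in> S" "labels a \<subseteq> I" "labels b \<subseteq> I" "labels c \<subseteq> I"
  shows "op_ideal P (leaves a + leaves b + leaves c)
    (basis (graft (graft (graft (quad_tree z) 2 c) 1 b) 0 a))"
proof -
  have q: "leaves (quad_tree z) = 3"
    by (cases z rule: quad_tree.cases) auto
  have "op_ideal P (leaves (quad_tree z)) (basis (quad_tree z))"
    using op_ideal.rel[OF rels_basis[OF assms(1)]] q by simp
  from op_ideal_graft_left[OF op_ideal_graft_left[OF op_ideal_graft_left[OF this]], of 2 c 1 b 0 a]
  show ?thesis
    using q assms leaves_pos[of a] leaves_pos[of b] leaves_pos[of c]
    by (simp add: ac_simps numeral_3_eq_3)
qed

lemma op_ideal_basis:
  "labels t \<subseteq> I \<Longrightarrow> edges t \<inter> S \<noteq> {} \<Longrightarrow> op_ideal P (leaves t) (basis t)"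
proof (induction t)
  case (Node i l r)
  then have I: "i \<in> I" "labels l \<subseteq> I" "labels r \<subseteq> I"
    by auto
  consider "edges l \<inter> S \<noteq> {}" | "edges r \<inter> S \<noteq> {}"
    | j a b where "l = Node j a b" "(TR, j, i) \<in> S" | j a b where "r = Node j a b" "(TL, i, j) \<in> S"
    using Node.prems by (cases l; cases r) auto
  then show ?case
  proof cases
    case 1
    then show ?thesis
      using op_ideal_graft_right[of l 0 "Node i Leaf r"] Node.IH(1) I by simp
  next
    case 2
    then show ?thesis
      using op_ideal_graft_right[of r "leaves l" "Node i l Leaf"] Node.IH(2) I by simp
  next
    case 3
    then show ?thesis
      using op_ideal_quad_tree[of "(TR, j, i)" a b r] I by simp
  next
    case 4
    then show ?thesis
      using op_ideal_quad_tree[of "(TL, i, j)" l a b] I by (simp add: ac_simps)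
  qed
qed simp

lemma op_ideal_iff: "op_ideal P n x \<longleftrightarrow> x \<in> vspace (bad_trees I S n)"
proof -
  have "free_vs.subspace {x. op_ideal P n x}"
    using op_ideal.intros by (auto simp: free_vs.subspace_def)
  then have "{x. op_ideal P n x} = free_vs.span {x. op_ideal P n x}"
    by (rule free_vs.span_eq_iff[THEN iffD2, symmetric])
  also have "\<dots> = vspace (bad_trees I S n)"
    using op_ideal_imp op_ideal_basis
    by (intro span_eq_vspace) (auto simp: bad_trees_def trees_def)
  finally show ?thesis
    by auto
qed

end

lemma monomial_presentation_monomial_operad:
  "S \<subseteq> UNIV \<times> I \<times> I \<Longrightarrow> monomial_presentation (monomial_operad I S) I S"
  by unfold_locales (auto simp: monomial_operad_def)

lemma eval_dual_basis [simp]: "eval_dual f (basis t) = Poly_Mapping.lookup f t"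
  by (simp add: eval_dual_def)

lemma lookup_basis_quad_tree:
  "Poly_Mapping.lookup (basis (quad_tree z)) (quad_tree z') = (if z = z' then 1 else 0)"
  by (simp add: lookup_single when_def inj_eq[OF inj_quad_tree])

text \<open>
  The pairing is diagonal in the monomial basis, with entries \<open>1\<close> and \<open>-1\<close>; the signs do not matter for
  the orthogonal of a set of monomials.
\<close>

lemma quad_pairing_basis:
  assumes "finite I" "z \<in> UNIV \<times> I \<times> I"
  shows "quad_pairing I y (basis (quad_tree z)) = 0 \<longleftrightarrow> Poly_Mapping.lookup y (quad_tree z) = 0"
proof -
  obtain T i j where z: "z = (T, i, j)"
    by (cases z)
  define c :: 'b where "c = (if T = TR then 1 else -1)"
  have "quad_pairing I y (basis (quad_tree z)) =
      (\<Sum>p\<in>I \<times> I. if p = (i, j) then c * Poly_Mapping.lookup y (quad_tree z) else 0)"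
    unfolding quad_pairing_def
  proof (intro sum.cong refl)
    fix p assume "p \<in> I \<times> I"
    obtain i' j' where p: "p = (i', j')"
      by (cases p)
    show "(case p of (i', j') \<Rightarrow>
        Poly_Mapping.lookup y (quad_tree (TR, i', j')) *
          Poly_Mapping.lookup (basis (quad_tree z)) (quad_tree (TR, i', j')) -
        Poly_Mapping.lookup y (quad_tree (TL, i', j')) *
          Poly_Mapping.lookup (basis (quad_tree z)) (quad_tree (TL, i', j'))) =
      (if p = (i, j) then c * Poly_Mapping.lookup y (quad_tree z) else 0)"
      unfolding p prod.case lookup_basis_quad_tree z c_def
      by (cases T) (auto simp del: quad_tree.simps)
  qed
  also have "\<dots> = c * Poly_Mapping.lookup y (quad_tree z)"
    using assms by (simp add: z)
  finally show ?thesis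
    by (simp add: c_def)
qed

lemma monomial_presentation_koszul_dual:
  assumes "finite I" "S \<subseteq> UNIV \<times> I \<times> I"
  shows "monomial_presentation (koszul_dual (monomial_operad I S) :: ('i, 'k::field) quadratic) I
    (UNIV \<times> I \<times> I - S)"
proof -
  let ?U = "UNIV \<times> I \<times> I" and ?P = "monomial_operad I S :: ('i, 'k) quadratic"
  have pairing: "quad_pairing I y (basis (quad_tree z)) = 0 \<longleftrightarrow>
      Poly_Mapping.lookup y (quad_tree z) = 0" if "z \<in> S" for y :: "'i pbt \<Rightarrow>\<^sub>0 'k" and z
    using quad_pairing_basis[OF assms(1)] assms(2) that by blast
  have "rels (koszul_dual ?P) =
      {y \<in> vspace (quad_tree ` ?U). \<forall>z\<in>S. Poly_Mapping.lookup y (quad_tree z) = 0}"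
    using pairing by (auto simp: koszul_dual_def monomial_operad_def free_op_eq_vspace trees_3)
  also have "\<dots> = vspace (quad_tree ` (?U - S))"
  proof (intro set_eqI iffI)
    fix y :: "'i pbt \<Rightarrow>\<^sub>0 'k"
    assume "y \<in> {y \<in> vspace (quad_tree ` ?U). \<forall>z\<in>S. Poly_Mapping.lookup y (quad_tree z) = 0}"
    then show "y \<in> vspace (quad_tree ` (?U - S))"
      unfolding vspace_def in_keys_iff subset_iff by blast
  next
    fix y :: "'i pbt \<Rightarrow>\<^sub>0 'k"
    assume y: "y \<in> vspace (quad_tree ` (?U - S))"
    have "quad_tree z \<notin> quad_tree ` (?U - S)" if "z \<in> S" for z
      using that injD[OF inj_quad_tree] by blast
    then have "Poly_Mapping.lookup y (quad_tree z) = 0" if "z \<in> S" for z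
      using that y unfolding vspace_def in_keys_iff subset_iff by blast
    moreover have "y \<in> vspace (quad_tree ` ?U)"
      using y vspace_mono[of "quad_tree ` (?U - S)" "quad_tree ` ?U"] by blast
    ultimately show "y \<in> {y \<in> vspace (quad_tree ` ?U). \<forall>z\<in>S. Poly_Mapping.lookup y (quad_tree z) = 0}"
      by blast
  qed
  finally have "rels (koszul_dual ?P) = vspace (quad_tree ` (?U - S))" .
  moreover have "gens (koszul_dual ?P) = I"
    by (simp add: koszul_dual_def monomial_operad_def)
  ultimately show ?thesis
    by unfold_locales auto
qed

text \<open>
  The trees that avoid \<open>S\<close>, which form a basis of the monomial operad with relations \<open>S\<close>.
\<close>

definition good_trees :: "'i set \<Rightarrow> (Y2 \<times> 'i \<times> 'i) set \<Rightarrow> nat \<Rightarrow> 'i pbt set" where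
  "good_trees I S n = {t \<in> trees I n. edges t \<inter> S = {}}"

lemma dual_component_koszul_dual:
  assumes "finite I" "S \<subseteq> UNIV \<times> I \<times> I"
  shows "dual_component (koszul_dual (monomial_operad I S)) n =
    vspace (good_trees I (UNIV \<times> I \<times> I - S) n)"
proof -
  let ?P = "koszul_dual (monomial_operad I S) :: ('a, 'b) quadratic"
  let ?S = "UNIV \<times> I \<times> I - S"
  interpret monomial_presentation ?P I ?S
    by (rule monomial_presentation_koszul_dual[OF assms])
  have "(\<forall>x. x \<in> vspace (bad_trees I ?S n) \<longrightarrow> eval_dual f x = 0) \<longleftrightarrow>
      Poly_Mapping.keys f \<inter> bad_trees I ?S n = {}" (is "?L = ?R") for f :: "'a pbt \<Rightarrow>\<^sub>0 'b"
  proof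
    assume ?L
    then have "eval_dual f (basis t) = 0" if "t \<in> bad_trees I ?S n" for t
      using vspace_single[OF that] by blast
    then show ?R
      by (auto simp: in_keys_iff)
  next
    assume ?R
    then show ?L
      unfolding eval_dual_def
      by (intro allI impI sum.neutral) (auto dest!: vspaceD simp: in_keys_iff)
  qed
  then show ?thesis
    unfolding dual_component_def op_ideal_iff gens free_op_eq_vspace
    by (auto simp: vspace_def good_trees_def bad_trees_def)
qed

section \<open>Bases of the chain spaces\<close>

text \<open>
  The monomials of the free algebra: trees whose leaves carry elements of the basis \<open>B\<close>.
\<close>

definition words :: "'i set \<Rightarrow> 'v set \<Rightarrow> ('i pbt \<times> 'v list) set" where
  "words I B = {(t, us). t \<in> trees I (length us) \<and> set us \<subseteq> B}"

text \<open>
  The monomials that vanish in the free algebra over the monomial operad with relations \<open>S\<close>.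
\<close>

definition bad_words :: "'i set \<Rightarrow> (Y2 \<times> 'i \<times> 'i) set \<Rightarrow> 'v set \<Rightarrow> ('i pbt \<times> 'v list) set" where
  "bad_words I S B = {(t, us) \<in> words I B. edges t \<inter> S \<noteq> {}}"

lemma bad_words_iff: "w \<in> bad_words I S B \<longleftrightarrow> w \<in> words I B \<and> edges (fst w) \<inter> S \<noteq> {}"
  by (cases w) (simp add: bad_words_def)

lemma tensor_list_in_vspace_lists:
  "set vs \<subseteq> vspace B \<Longrightarrow> tensor_list vs \<in> vspace {us. length us = length vs \<and> set us \<subseteq> B}"
proof (induction vs)
  case (Cons v vs)
  then have "v \<in> vspace B" "tensor_list vs \<in> vspace {us. length us = length vs \<and> set us \<subseteq> B}"
    by auto
  then show ?case
    unfolding tensor_list.simps by (rule bilin_ext_in_vspace) auto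
qed simp

lemma tensor_basis: "tensor (basis t) (tensor_list (map basis us)) = basis (t, us)"
  by (simp add: tensor_list_basis)

lemma free_alg_eq_vspace: "free_alg I B = vspace (words I B)"
  unfolding free_alg_def free_op_eq_vspace
proof (rule span_eq_vspace)
  show "{tensor x (tensor_list vs) | x vs. x \<in> vspace (trees I (length vs)) \<and> set vs \<subseteq> vspace B}
      \<subseteq> vspace (words I B)"
    by (auto intro!: bilin_ext_in_vspace tensor_list_in_vspace_lists simp: words_def)
  show "basis w \<in> {tensor x (tensor_list vs) | x vs.
      x \<in> vspace (trees I (length vs)) \<and> set vs \<subseteq> vspace B}" if w: "w \<in> words I B" for w
  proof -
    obtain t us where "w = (t, us)" by (cases w)
    moreover from this w have "basis t \<in> vspace (trees I (length (map basis us)))"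
      "set (map basis us) \<subseteq> vspace B"
      by (auto simp: words_def)
    ultimately show ?thesis
      using tensor_basis[of t us] by (metis (mono_tags, lifting) mem_Collect_eq)
  qed
qed

lemma (in monomial_presentation) null_alg_eq_vspace: "null_alg P B = vspace (bad_words I S B)"
  unfolding null_alg_def op_ideal_iff
proof (rule span_eq_vspace)
  show "{tensor x (tensor_list vs) | x vs. x \<in> vspace (bad_trees I S (length vs)) \<and> set vs \<subseteq> vspace B}
      \<subseteq> vspace (bad_words I S B)"
    by (auto intro!: bilin_ext_in_vspace tensor_list_in_vspace_lists
        simp: bad_words_def words_def bad_trees_def)
  show "basis w \<in> {tensor x (tensor_list vs) | x vs.
      x \<in> vspace (bad_trees I S (length vs)) \<and> set vs \<subseteq> vspace B}" if w: "w \<in> bad_words I S B" for w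
  proof -
    obtain t us where "w = (t, us)" by (cases w)
    moreover from this w have "basis t \<in> vspace (bad_trees I S (length (map basis us)))"
      "set (map basis us) \<subseteq> vspace B"
      by (auto simp: bad_words_def words_def bad_trees_def)
    ultimately show ?thesis
      using tensor_basis[of t us] by (metis (mono_tags, lifting) mem_Collect_eq)
  qed
qed

text \<open>
  The cells \<open>(t, ws)\<close> of degree \<open>n\<close>: the complement of \<open>Z\<close> consists of the relations of the Koszul
  dual, so that all edges of \<open>t\<close> are in \<open>Z\<close>.
\<close>

definition cells :: "'i set \<Rightarrow> (Y2 \<times> 'i \<times> 'i) set \<Rightarrow> 'v set \<Rightarrow> nat \<Rightarrow>
    ('i pbt \<times> ('i pbt \<times> 'v list) list) set" where
  "cells I Z B n = {(t, ws). t \<in> good_trees I (UNIV \<times> I \<times> I - Z) n \<and> length ws = n \<and>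
    set ws \<subseteq> words I B}"

text \<open>
  The cells that have a vanishing word, and hence are zero in the Koszul complex.
\<close>

definition null_cells :: "'i set \<Rightarrow> (Y2 \<times> 'i \<times> 'i) set \<Rightarrow> 'v set \<Rightarrow> nat \<Rightarrow>
    ('i pbt \<times> ('i pbt \<times> 'v list) list) set" where
  "null_cells I Z B n = {(t, ws) \<in> cells I Z B n. set ws \<inter> bad_words I Z B \<noteq> {}}"

lemma koszul_chains_eq_vspace:
  assumes "finite I" "Z \<subseteq> UNIV \<times> I \<times> I"
  shows "koszul_chains (monomial_operad I Z) B n = vspace (cells I Z B n)"
proof -
  have g: "gens (monomial_operad I Z) = I" by (simp add: monomial_operad_def)
  show ?thesis
    unfolding koszul_chains_def g free_alg_eq_vspace dual_component_koszul_dual[OF assms]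
  proof (rule span_eq_vspace, goal_cases)
    case 1
    show ?case
      by (auto intro!: bilin_ext_in_vspace tensor_list_in_vspace_lists simp: cells_def)
  next
    case (2 c)
    obtain t ws where "c = (t, ws)" by (cases c)
    moreover from this 2 have "basis t \<in> vspace (good_trees I (UNIV \<times> I \<times> I - Z) n)"
      "length (map basis ws) = n" "set (map basis ws) \<subseteq> vspace (words I B)"
      by (auto simp: cells_def)
    ultimately show ?case
      using tensor_basis[of t ws] by (metis (mono_tags, lifting) mem_Collect_eq)
  qed
qed

lemma koszul_null_eq_vspace:
  assumes "finite I" "Z \<subseteq> UNIV \<times> I \<times> I"
  shows "koszul_null (monomial_operad I Z) B n = vspace (null_cells I Z B n)"
proof -
  have g: "gens (monomial_operad I Z) = I" by (simp add: monomial_operad_def)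
  interpret monomial_presentation "monomial_operad I Z" I Z
    by (rule monomial_presentation_monomial_operad[OF assms(2)])
  show ?thesis
    unfolding koszul_null_def g free_alg_eq_vspace null_alg_eq_vspace
      dual_component_koszul_dual[OF assms]
  proof (rule span_eq_vspace, goal_cases)
    case 1
    show ?case
    proof
      fix c :: "'a pbt \<times> ('a pbt \<times> 'b list) list \<Rightarrow>\<^sub>0 'c"
      assume "c \<in> {tensor f (tensor_list as) | f as.
        f \<in> vspace (good_trees I (UNIV \<times> I \<times> I - Z) n) \<and> length as = n \<and>
        set as \<subseteq> vspace (words I B) \<and> set as \<inter> vspace (bad_words I Z B) \<noteq> {}}"
      then obtain f as x where c: "c = tensor f (tensor_list as)" and n: "length as = n"
        and f: "f \<in> vspace (good_trees I (UNIV \<times> I \<times> I - Z) n)"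
        and as: "set as \<subseteq> vspace (words I B)"
        and x: "x \<in> set as" "x \<in> vspace (bad_words I Z B)"
        by blast
      obtain i where i: "i < length as" "x = as ! i"
        using x(1) by (auto simp: in_set_conv_nth)
      define As where "As = (replicate (length as) (words I B))[i := bad_words I Z B]"
      have "list_all2 (\<lambda>x A. x \<in> vspace A) as As"
        using as x(2) i by (auto simp: list_all2_conv_all_nth As_def nth_list_update subset_iff)
      then have "tensor_list as \<in> vspace {ws. list_all2 (\<in>) ws As}"
        by (rule tensor_list_in_vspace)
      moreover have "length ws = length as \<and> set ws \<subseteq> words I B \<and> set ws \<inter> bad_words I Z B \<noteq> {}"
        if "list_all2 (\<in>) ws As" for ws
      proof -
        have l: "length ws = length as" and nth: "\<And>j. j < length as \<Longrightarrow> ws ! j \<in> As ! j"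
          using that by (auto simp: list_all2_conv_all_nth As_def)
        have bad: "ws ! i \<in> bad_words I Z B"
          using nth[OF i(1)] i(1) by (simp add: As_def)
        have "ws ! j \<in> words I B" if "j < length as" for j
          using nth[OF that] that by (cases "j = i") (auto simp: As_def bad_words_def)
        then have "set ws \<subseteq> words I B"
          using l by (auto simp: set_conv_nth)
        moreover have "ws ! i \<in> set ws"
          using i(1) l by simp
        ultimately show ?thesis
          using l bad by blast
      qed
      ultimately show "c \<in> vspace (null_cells I Z B n)"
        unfolding c using f n by (elim bilin_ext_in_vspace) (auto simp: null_cells_def cells_def)
    qed
  next
    case (2 c)
    obtain t ws where c: "c = (t, ws)" by (cases c)
    moreover from this 2 have "basis t \<in> vspace (good_trees I (UNIV \<times> I \<times> I - Z) n)"
      "length (map basis ws) = n" "set (map basis ws) \<subseteq> vspace (words I B)"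
      by (auto simp: null_cells_def cells_def)
    moreover have "set (map basis ws) \<inter> vspace (bad_words I Z B) \<noteq> {}"
    proof -
      obtain w where "w \<in> set ws" "w \<in> bad_words I Z B"
        using 2 c by (auto simp: null_cells_def)
      then have "basis w \<in> set (map basis ws) \<inter> vspace (bad_words I Z B)"
        by auto
      then show ?thesis by blast
    qed
    ultimately show ?case
      using tensor_basis[of t ws] by (metis (mono_tags, lifting) mem_Collect_eq)
  qed
qed

section \<open>Cherries\<close>

abbreviation cherry :: "'i \<Rightarrow> 'i pbt" where
  "cherry i \<equiv> Node i Leaf Leaf"

lemma graft_eq_cherry: "k < leaves s \<Longrightarrow> graft s k (cherry i) = cherry j \<Longrightarrow> s = Leaf \<and> i = j"
proof (cases s)
  case (Node i' l r)
  assume "k < leaves s" "graft s k (cherry i) = cherry j"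
  then have "leaves s + 1 = 2"
    using leaves_graft[of k s "cherry i"] by simp
  then show ?thesis
    using Node leaves_pos[of l] leaves_pos[of r] by simp
qed simp

lemma graft_cherry_inject:
  "k < leaves s \<Longrightarrow> k < leaves s' \<Longrightarrow> graft s k (cherry i) = graft s' k (cherry j) \<Longrightarrow>
    s = s' \<and> i = j"
proof (induction s arbitrary: s' k)
  case Leaf
  then show ?case
    using graft_eq_cherry[of k s' j i] by auto
next
  case (Node a l r)
  show ?case
  proof (cases s')
    case Leaf
    then show ?thesis
      using Node.prems graft_eq_cherry[of k "Node a l r" i j] by auto
  next
    case s': (Node b l' r')
    have "k < leaves l \<longleftrightarrow> k < leaves l'"
      using Node.prems s' leaves_graft[of k l "cherry i"] leaves_graft[of k l' "cherry j"]
      by (auto split: if_splits)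
    then show ?thesis
      using Node.prems s' Node.IH(1)[of k l'] Node.IH(2)[of "k - leaves l" r']
      by (cases "k < leaves l") auto
  qed
qed

lemma graft_commute:
  "l < k \<Longrightarrow> k < leaves s \<Longrightarrow>
    graft (graft s k a) l b = graft (graft s l b) (k + leaves b - 1) a"
proof (induction s arbitrary: k l)
  case (Node i s1 s2)
  consider "k < leaves s1" | "l < leaves s1" "leaves s1 \<le> k" | "leaves s1 \<le> l"
    using Node.prems by linarith
  then show ?case
  proof cases
    case 1
    then show ?thesis
      using Node leaves_pos[of a] leaves_pos[of b] by auto
  next
    case 2
    then show ?thesis
      using Node.prems leaves_pos[of b] by auto
  next
    case 3
    then have "k + leaves b - Suc 0 - leaves s1 = (k - leaves s1) + leaves b - Suc 0"
      using Node.prems by simp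
    then show ?thesis
      using 3 Node.prems leaves_pos[of b] Node.IH(2)[of "l - leaves s1" "k - leaves s1"] by auto
  qed
qed auto

lemma graft_cherry_commute:
  "l < k \<Longrightarrow> k < leaves s \<Longrightarrow>
    graft (graft s k (cherry i)) l (cherry j) = graft (graft s l (cherry j)) (Suc k) (cherry i)"
  using graft_commute[of l k s "cherry i" "cherry j"] by simp

text \<open>
  Two different cherries of a tree are disjoint: they can be removed one after the other, in both
  orders.  In \<open>graft s k (cherry i)\<close> the cherry occupies the leaves \<open>k\<close> and \<open>k + 1\<close>, so that
  disjointness means \<open>l + 1 < k\<close>.
\<close>

lemma two_cherries:
  "k < leaves s \<Longrightarrow> l < leaves s' \<Longrightarrow> l < k \<Longrightarrow>
    graft s k (cherry i) = graft s' l (cherry j) \<Longrightarrow>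
    Suc l < k \<and> (\<exists>u. k - 1 < leaves u \<and> s = graft u l (cherry j) \<and> s' = graft u (k - 1) (cherry i))"
proof (induction s arbitrary: s' k l)
  case (Node a s1 s2)
  obtain b s1' s2' where s': "s' = Node b s1' s2'"
    using Node.prems graft_eq_cherry[of k "Node a s1 s2" i j] by (cases s') auto
  consider "k < leaves s1" "l < leaves s1'" | "k < leaves s1" "leaves s1' \<le> l"
    | "leaves s1 \<le> k" "l < leaves s1'" | "leaves s1 \<le> k" "leaves s1' \<le> l"
    by linarith
  then show ?case
  proof cases
    case 1
    then have eq: "graft s1 k (cherry i) = graft s1' l (cherry j)" "a = b" "s2 = s2'"
      using Node.prems s' by auto
    from Node.IH(1)[OF 1 Node.prems(3) eq(1)] obtain u where
      u: "Suc l < k" "k - 1 < leaves u" "s1 = graft u l (cherry j)" "s1' = graft u (k - 1) (cherry i)"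
      by blast
    then show ?thesis
      using s' eq by (intro conjI exI[of _ "Node a u s2"]) auto
  next
    case 2
    then have "graft s1 k (cherry i) = s1'"
      using Node.prems s' by auto
    then show ?thesis
      using leaves_graft[OF 2(1), of "cherry i"] 2 Node.prems by auto
  next
    case 3
    then have eq: "s1 = graft s1' l (cherry j)" "graft s2 (k - leaves s1) (cherry i) = s2'" "a = b"
      using Node.prems s' by auto
    then have "leaves s1 = Suc (leaves s1')"
      using leaves_graft[OF 3(2), of "cherry j"] by simp
    then show ?thesis
      using 3 eq s' Node.prems by (intro conjI exI[of _ "Node a s1' s2"]) auto
  next
    case 4
    then have eq: "s1 = s1'" "a = b"
      "graft s2 (k - leaves s1) (cherry i) = graft s2' (l - leaves s1) (cherry j)"
      using Node.prems s' by auto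
    from Node.IH(2)[OF _ _ _ eq(3)] obtain u where
      u: "Suc (l - leaves s1) < k - leaves s1" "k - leaves s1 - 1 < leaves u"
        "s2 = graft u (l - leaves s1) (cherry j)" "s2' = graft u (k - leaves s1 - 1) (cherry i)"
      using 4 Node.prems s' eq(1) by fastforce
    then show ?thesis
      using s' eq 4 by (intro conjI exI[of _ "Node a s1 u"]) (auto simp: diff_right_commute)
  qed
qed auto

lemma parents_graft_cherry:
  "k < leaves s \<Longrightarrow> parents p (graft s k (cherry i)) =
    take k (parents p s) @ Some (TR, i) # Some (TL, i) # drop (Suc k) (parents p s)"
proof (induction s arbitrary: k p)
  case (Node j l r)
  show ?case
  proof (cases "k < leaves l")
    case True
    then show ?thesis
      using Node.IH(1) by simp
  next
    case False
    then have "k - leaves l < leaves r" "Suc k - leaves l = Suc (k - leaves l)"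
      using Node.prems by auto
    then show ?thesis
      using False Node.IH(2) by simp
  qed
qed simp

lemma nth_parents_graft_cherry:
  assumes "k < leaves s"
  shows "l < k \<Longrightarrow> parents p (graft s k (cherry i)) ! l = parents p s ! l"
    and "parents p (graft s k (cherry i)) ! k = Some (TR, i)"
    and "parents p (graft s k (cherry i)) ! Suc k = Some (TL, i)"
  using assms by (auto simp: parents_graft_cherry nth_append)

lemma two_le_leaves_Node: "2 \<le> leaves (Node i l r)"
  using leaves_pos[of l] leaves_pos[of r] by (simp del: leaves_pos)

lemma exists_cherry: "2 \<le> leaves t \<Longrightarrow> \<exists>s k i. k < leaves s \<and> t = graft s k (cherry i)"
proof (induction t)
  case (Node i l r)
  consider "l = Leaf" "r = Leaf" | "2 \<le> leaves l" | "2 \<le> leaves r"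
    by (metis two_le_leaves_Node pbt.exhaust)
  then show ?case
  proof cases
    case 1
    then have "Node i l r = graft Leaf 0 (cherry i)"
      by simp
    then show ?thesis
      by (metis leaves_pos)
  next
    case 2
    then obtain s k j where "k < leaves s" "l = graft s k (cherry j)"
      using Node.IH(1) by blast
    then have "k < leaves (Node i s r)" "Node i l r = graft (Node i s r) k (cherry j)"
      by auto
    then show ?thesis
      by blast
  next
    case 3
    then obtain s k j where "k < leaves s" "r = graft s k (cherry j)"
      using Node.IH(2) by blast
    then have "leaves l + k < leaves (Node i l s)"
      "Node i l r = graft (Node i l s) (leaves l + k) (cherry j)"
      by auto
    then show ?thesis
      by blast
  qed
qed simp

section \<open>Merging adjacent words\<close>

text \<open>
  Replaces the words at the positions \<open>k\<close> and \<open>k + 1\<close> by the result of the operation \<open>\<circ>\<^sub>i\<close>.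
\<close>

definition merge :: "nat \<Rightarrow> 'i \<Rightarrow> ('i pbt \<times> 'v list) list \<Rightarrow> ('i pbt \<times> 'v list) list" where
  "merge k i ws = take k ws @ alg_op i (ws ! k) (ws ! Suc k) # drop (k + 2) ws"

lemma length_merge [simp]: "Suc k < length ws \<Longrightarrow> length (merge k i ws) = length ws - 1"
  by (simp add: merge_def)

lemma nth_merge:
  "Suc k < length ws \<Longrightarrow> m < length ws - 1 \<Longrightarrow> merge k i ws ! m =
    (if m < k then ws ! m else if m = k then alg_op i (ws ! k) (ws ! Suc k) else ws ! Suc m)"
  by (auto simp: merge_def nth_append nth_Cons' Suc_diff_Suc)

lemma merge_commute:
  assumes "Suc l < k" "Suc k < length ws"
  shows "merge l j (merge k i ws) = merge (k - 1) i (merge l j ws)"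
proof (rule nth_equalityI)
  show "length (merge l j (merge k i ws)) = length (merge (k - 1) i (merge l j ws))"
    using assms by simp
  fix m assume "m < length (merge l j (merge k i ws))"
  then have m: "m < length ws - 2"
    using assms by simp
  show "merge l j (merge k i ws) ! m = merge (k - 1) i (merge l j ws) ! m"
    using m assms by (simp add: nth_merge) linarith
qed

lemma set_merge:
  "Suc k < length ws \<Longrightarrow> set (merge k i ws) \<subseteq> insert (alg_op i (ws ! k) (ws ! Suc k)) (set ws)"
  unfolding merge_def using set_take_subset[of k ws] set_drop_subset[of "k + 2" ws] by auto

lemma merged_in_set: "Suc k < length ws \<Longrightarrow> alg_op i (ws ! k) (ws ! Suc k) \<in> set (merge k i ws)"
  by (simp add: merge_def)

lemma set_subset_set_merge:
  assumes "Suc k < length ws" "w \<in> set ws" "w \<noteq> ws ! k" "w \<noteq> ws ! Suc k"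
  shows "w \<in> set (merge k i ws)"
proof -
  have "ws = take k ws @ ws ! k # ws ! Suc k # drop (k + 2) ws"
    using assms(1) id_take_nth_drop[of k ws] Cons_nth_drop_Suc[of "Suc k" ws] by simp
  then have "set ws = set (take k ws) \<union> {ws ! k, ws ! Suc k} \<union> set (drop (k + 2) ws)"
    by (metis (no_types, lifting) Un_insert_right list.simps(15) set_append insert_is_Un Un_assoc)
  then show ?thesis
    using assms by (auto simp: merge_def)
qed

section \<open>The matching on cells\<close>

text \<open>
  The partial function value determined by a predicate, meant for predicates with at most one solution.
\<close>

definition pick :: "('a \<Rightarrow> bool) \<Rightarrow> 'a option" where
  "pick P = (if \<exists>y. P y then Some (SOME y. P y) else None)"

lemma pick_eq_Some_iff:
  "(\<And>y y'. P y \<Longrightarrow> P y' \<Longrightarrow> y = y') \<Longrightarrow> pick P = Some y \<longleftrightarrow> P y"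
  unfolding pick_def by (metis option.inject option.distinct(1) someI)

lemma pick_eq_None_iff: "pick P = None \<longleftrightarrow> (\<forall>y. \<not> P y)"
  by (auto simp: pick_def)

text \<open>
  The operation can be undone, since the length of the first word is the number of leaves of the first
  tree.
\<close>

lemma alg_op_inject:
  assumes "alg_op i v w = alg_op i' v' w'" "v \<in> words I B" "v' \<in> words I B"
  shows "i = i' \<and> v = v' \<and> w = w'"
  using assms by (cases v; cases v'; cases w; cases w') (auto simp: words_def trees_def)

lemma alg_op_in_words: "v \<in> words I B \<Longrightarrow> w \<in> words I B \<Longrightarrow> i \<in> I \<Longrightarrow> alg_op i v w \<in> words I B"
  by (cases v; cases w) (auto simp: words_def trees_def)

lemma edges_alg_op:
  "edges (fst (alg_op i v w)) =
    link (Some (TR, i)) (fst v) \<union> edges (fst v) \<union> (link (Some (TL, i)) (fst w) \<union> edges (fst w))"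
  by (cases v; cases w) simp

lemma merge_inject:
  assumes eq: "merge k i ws = merge k i' ws'"
    and len: "Suc k < length ws" "Suc k < length ws'"
    and words: "set ws \<subseteq> words I B" "set ws' \<subseteq> words I B"
  shows "i = i' \<and> ws = ws'"
proof -
  have "length (merge k i ws) = length (merge k i' ws')"
    using eq by simp
  then have len_eq: "length ws = length ws'"
    using len by simp
  have nth: "merge k i ws ! m = merge k i' ws' ! m" for m
    using eq by simp
  have "alg_op i (ws ! k) (ws ! Suc k) = alg_op i' (ws' ! k) (ws' ! Suc k)"
    using nth[of k] len by (simp add: nth_merge)
  moreover have "ws ! k \<in> words I B" "ws' ! k \<in> words I B"
    using subsetD[OF words(1), of "ws ! k"] subsetD[OF words(2), of "ws' ! k"] len by auto
  ultimately have k: "i = i' \<and> ws ! k = ws' ! k \<and> ws ! Suc k = ws' ! Suc k"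
    by (rule alg_op_inject)
  have "ws ! m = ws' ! m" if "m < length ws" for m
  proof -
    consider "m < k" | "m = k \<or> m = Suc k" | "Suc k < m"
      by linarith
    then show ?thesis
    proof cases
      case 1
      then show ?thesis
        using nth[of m] len by (simp add: nth_merge)
    next
      case 2
      then show ?thesis
        using k by auto
    next
      case 3
      then show ?thesis
        using nth[of "m - 1"] len len_eq that by (simp add: nth_merge split: if_splits)
    qed
  qed
  then show ?thesis
    using k len_eq by (auto intro: nth_equalityI)
qed

text \<open>
  Removal of the cherry at the leaves \<open>k\<close> and \<open>k + 1\<close> of the tree, with its operation applied to the two
  words on it.
\<close>

definition step :: "nat \<Rightarrow> 'i pbt \<times> ('i pbt \<times> 'v list) list \<Rightarrow> 'i pbt \<times> ('i pbt \<times> 'v list) list \<Rightarrow> bool" where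
  "step k x y \<longleftrightarrow> (\<exists>s i. k < leaves s \<and> fst x = graft s k (cherry i) \<and> y = (s, merge k i (snd x)))"

lemma step_unique: "step k x y \<Longrightarrow> step k x y' \<Longrightarrow> y = y'"
  unfolding step_def using graft_cherry_inject by metis

text \<open>
  The \<open>k\<close>-th summand of the Koszul differential, up to its sign, before passing to the quotient by
  the null chains.
\<close>

definition face :: "nat \<Rightarrow> 'i pbt \<times> ('i pbt \<times> 'v list) list \<Rightarrow> ('i pbt \<times> ('i pbt \<times> 'v list) list) option" where
  "face k x = pick (step k x)"

lemma face_eq_Some_iff: "face k x = Some y \<longleftrightarrow> step k x y"
  unfolding face_def by (rule pick_eq_Some_iff) (rule step_unique)

text \<open>
  The monomial basis of the free algebra over the monomial operad with relations \<open>Z\<close>.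
\<close>

definition good_words :: "'i set \<Rightarrow> (Y2 \<times> 'i \<times> 'i) set \<Rightarrow> 'v set \<Rightarrow> ('i pbt \<times> 'v list) set" where
  "good_words I Z B = {w \<in> words I B. edges (fst w) \<inter> Z = {}}"

lemma good_words_eq: "good_words I S B = words I B - bad_words I S B"
  by (auto simp: good_words_def bad_words_iff simp del: split_paired_All)

text \<open>
  The cells, of all degrees, that do not vanish in the Koszul complex.
\<close>

definition good_cells :: "'i set \<Rightarrow> (Y2 \<times> 'i \<times> 'i) set \<Rightarrow> 'v set \<Rightarrow>
    ('i pbt \<times> ('i pbt \<times> 'v list) list) set" where
  "good_cells I Z B = {(t, ws). labels t \<subseteq> I \<and> edges t \<subseteq> Z \<and> length ws = leaves t \<and>
    set ws \<subseteq> good_words I Z B}"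

locale cell_matching =
  fixes I :: "'i set" and Z :: "(Y2 \<times> 'i \<times> 'i) set" and B :: "'v set"
begin

abbreviation G where "G \<equiv> good_cells I Z B"

text \<open>
  The moves that are nonzero in the Koszul complex: both cells have to be good.
\<close>

definition match where
  "match k x y \<longleftrightarrow> x \<in> G \<and> y \<in> G \<and> step k x y"

definition dn where "dn k x = pick (match k x)"
definition up where "up k y = pick (\<lambda>x. match k x y)"

lemma good_words_subset: "good_words I Z B \<subseteq> words I B"
  by (auto simp: good_words_def)

lemma matchE:
  assumes "match k x y"
  obtains s i ws where "k < leaves s" "length ws = Suc (leaves s)" "Suc k < length ws"
    "x = (graft s k (cherry i), ws)" "y = (s, merge k i ws)" "x \<in> G" "y \<in> G"
proof -
  obtain s i where s: "k < leaves s" "fst x = graft s k (cherry i)" "y = (s, merge k i (snd x))"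
    using assms by (auto simp: match_def step_def)
  obtain ws where x: "x = (graft s k (cherry i), ws)"
    using s(2) by (cases x) auto
  have "x \<in> G" "y \<in> G"
    using assms by (auto simp: match_def)
  moreover from this have "length ws = Suc (leaves s)"
    using x s(1) by (auto simp: good_cells_def)
  ultimately show ?thesis
    using that s x by simp
qed

lemma matchI:
  assumes "k < leaves s" "(graft s k (cherry i), ws) \<in> G" "(s, merge k i ws) \<in> G"
  shows "match k (graft s k (cherry i), ws) (s, merge k i ws)"
  using assms by (auto simp: match_def step_def)

lemma match_down_unique: "match k x y \<Longrightarrow> match k x y' \<Longrightarrow> y = y'"
  unfolding match_def using step_unique by blast

lemma match_up_unique:
  assumes "match k x y" "match k x' y"
  shows "x = x'"
proof -
  from assms(1) obtain s i ws where 1: "k < leaves s" "length ws = Suc (leaves s)"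
    "Suc k < length ws" "x = (graft s k (cherry i), ws)" "y = (s, merge k i ws)" "x \<in> G"
    by (rule matchE)
  from assms(2) obtain s' i' ws' where 2: "k < leaves s'" "length ws' = Suc (leaves s')"
    "Suc k < length ws'" "x' = (graft s' k (cherry i'), ws')" "y = (s', merge k i' ws')" "x' \<in> G"
    by (rule matchE)
  have "merge k i ws = merge k i' ws'"
    using 1 2 by simp
  moreover have "set ws \<subseteq> words I B" "set ws' \<subseteq> words I B"
    using 1 2 good_words_subset by (auto simp: good_cells_def)
  ultimately have "i = i' \<and> ws = ws'"
    using 1(3) 2(3) by (intro merge_inject)
  then show ?thesis
    using 1 2 by simp
qed

lemma dn_eq_Some_iff: "dn k x = Some y \<longleftrightarrow> match k x y"
  unfolding dn_def by (rule pick_eq_Some_iff) (rule match_down_unique)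

lemma up_eq_Some_iff: "up k y = Some x \<longleftrightarrow> match k x y"
  unfolding up_def by (rule pick_eq_Some_iff) (rule match_up_unique)

text \<open>
  The root vertex of the word at the leaf \<open>m\<close> can be moved up into the tree as soon as the edge that
  links it to its parent is in \<open>Z\<close>.
\<close>

lemma match_expand:
  assumes G: "(t, ws) \<in> G" and m: "m < leaves t" and w: "ws ! m = (Node j p q, us)"
    and link: "link (parents None t ! m) (Node j p q) \<subseteq> Z"
  shows "\<exists>x. match m x (t, ws)"
proof -
  define ws' where
    "ws' = take m ws @ (p, take (leaves p) us) # (q, drop (leaves p) us) # drop (Suc m) ws"
  have len: "m < length ws"
    using G m by (auto simp: good_cells_def)
  then have "ws ! m \<in> good_words I Z B"
    using G by (auto simp: good_cells_def)
  then have j: "j \<in> I" and pq: "(p, take (leaves p) us) \<in> good_words I Z B"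
      "(q, drop (leaves p) us) \<in> good_words I Z B"
    using w by (auto simp: good_words_def words_def trees_def dest: in_set_takeD in_set_dropD)
  have "merge m j ws' = take m ws @ ws ! m # drop (Suc m) ws"
    using len w by (simp add: merge_def ws'_def nth_append)
  then have "merge m j ws' = ws"
    using id_take_nth_drop[OF len] by simp
  moreover have "(graft t m (cherry j), ws') \<in> G"
  proof -
    have "edges (graft t m (cherry j)) \<subseteq> Z"
      using edges_graft[OF m] G link link_Node_cong[of "parents None t ! m" j p q Leaf Leaf]
      by (auto simp: good_cells_def)
    moreover have "set ws' \<subseteq> good_words I Z B"
      using pq G set_take_subset[of m ws] set_drop_subset[of "Suc m" ws]
      by (auto simp: ws'_def good_cells_def)
    moreover have "length ws' = Suc (leaves t)"
      using G len by (auto simp: ws'_def good_cells_def)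
    ultimately show ?thesis
      using G m j by (auto simp: good_cells_def)
  qed
  ultimately show ?thesis
    using matchI[OF m, of j ws'] G by auto
qed

text \<open>
  Two successive moves at overlapping positions would turn an edge of the tree \<open>t\<close>, which is in \<open>Z\<close>,
  into an edge of a word, which is not in \<open>Z\<close>.
\<close>

lemma match_no_nesting:
  assumes "match k x y" "match l y z"
  shows "l \<noteq> k \<and> Suc l \<noteq> k"
proof -
  from assms(1) obtain s i ws where x: "k < leaves s" "length ws = Suc (leaves s)"
    "Suc k < length ws" "x = (graft s k (cherry i), ws)" "y = (s, merge k i ws)" "x \<in> G" "y \<in> G"
    by (rule matchE)
  from assms(2) obtain u j vs where y: "l < leaves u" "length vs = Suc (leaves u)"
    "Suc l < length vs" "y = (graft u l (cherry j), vs)" "z = (u, merge l j vs)" "z \<in> G"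
    by (rule matchE)
  have s: "s = graft u l (cherry j)" and vs: "vs = merge k i ws"
    using x y by auto
  have "link (parents None s ! k) (cherry i) \<subseteq> Z"
    using x edges_graft[OF x(1), of "cherry i"] by (auto simp: good_cells_def)
  moreover have "alg_op j (vs ! l) (vs ! Suc l) \<in> good_words I Z B"
    using merged_in_set[OF y(3), of j] y(5,6) by (auto simp: good_cells_def)
  then have "edges (fst (alg_op j (vs ! l) (vs ! Suc l))) \<inter> Z = {}"
    by (simp add: good_words_def)
  moreover have "vs ! k = alg_op i (ws ! k) (ws ! Suc k)"
    using x by (simp add: vs nth_merge)
  then obtain a b where "fst (vs ! k) = Node i a b"
    by (cases "ws ! k"; cases "ws ! Suc k") auto
  ultimately show ?thesis
    using nth_parents_graft_cherry[OF y(1)] by (auto simp: s edges_alg_op)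
qed

lemma good_cellsI_graft:
  assumes "(graft s k (cherry i), ws) \<in> G" "k < leaves s" "set vs \<subseteq> good_words I Z B"
    "length vs = leaves s"
  shows "(s, vs) \<in> G"
  using assms by (auto simp: good_cells_def edges_graft)

lemma match_swap_left:
  assumes "match k x y" "match l y z" "Suc l < k"
  shows "\<exists>y'. match l x y' \<and> match (k - 1) y' z"
proof -
  from assms(1) obtain s i ws where x: "k < leaves s" "length ws = Suc (leaves s)"
    "Suc k < length ws" "x = (graft s k (cherry i), ws)" "y = (s, merge k i ws)" "x \<in> G" "y \<in> G"
    by (rule matchE)
  from assms(2) obtain u j vs where y: "l < leaves u" "length vs = Suc (leaves u)"
    "Suc l < length vs" "y = (graft u l (cherry j), vs)" "z = (u, merge l j vs)" "z \<in> G"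
    by (rule matchE)
  have s: "s = graft u l (cherry j)" and vs: "vs = merge k i ws"
    using x y by auto
  have leaves_s: "leaves s = Suc (leaves u)"
    using y(1) by (simp add: s)
  have k: "k - 1 < leaves u" "l < k - 1" "l < leaves (graft u (k - 1) (cherry i))"
    using x leaves_s assms(3) by auto
  have x': "x = (graft (graft u (k - 1) (cherry i)) l (cherry j), ws)"
    using graft_cherry_commute[OF k(2,1), of i j] x assms(3) by (simp add: s)
  have merge: "merge l j vs = merge (k - 1) i (merge l j ws)"
    unfolding vs using assms(3) x(3) by (rule merge_commute)
  have "vs ! l = ws ! l" "vs ! Suc l = ws ! Suc l"
    using x(3) assms(3) by (auto simp: vs nth_merge)
  then have "alg_op j (ws ! l) (ws ! Suc l) \<in> good_words I Z B"
    using merged_in_set[OF y(3), of j] y(5,6) by (auto simp: good_cells_def)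
  then have "set (merge l j ws) \<subseteq> good_words I Z B"
    using set_merge[of l ws j] x(3,4,6) assms(3) by (auto simp: good_cells_def)
  moreover have "length (merge l j ws) = leaves (graft u (k - 1) (cherry i))"
    using x(2,3) k leaves_s assms(3) by simp
  ultimately have G: "(graft u (k - 1) (cherry i), merge l j ws) \<in> G"
    by (rule good_cellsI_graft[OF x(6)[unfolded x'] k(3)])
  then show ?thesis
  proof (intro exI conjI)
    show "match l x (graft u (k - 1) (cherry i), merge l j ws)"
      unfolding x' using k(3) x(6)[unfolded x'] G by (rule matchI)
    show "match (k - 1) (graft u (k - 1) (cherry i), merge l j ws) z"
      unfolding y(5) merge using k(1) G y(6)[unfolded y(5) merge] by (rule matchI)
  qed
qed

lemma match_swap_right:
  assumes "match k x y" "match l y z" "k < l"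
  shows "\<exists>y'. match (Suc l) x y' \<and> match k y' z"
proof -
  from assms(1) obtain s i ws where x: "k < leaves s" "length ws = Suc (leaves s)"
    "Suc k < length ws" "x = (graft s k (cherry i), ws)" "y = (s, merge k i ws)" "x \<in> G" "y \<in> G"
    by (rule matchE)
  from assms(2) obtain u j vs where y: "l < leaves u" "length vs = Suc (leaves u)"
    "Suc l < length vs" "y = (graft u l (cherry j), vs)" "z = (u, merge l j vs)" "z \<in> G"
    by (rule matchE)
  have s: "s = graft u l (cherry j)" and vs: "vs = merge k i ws"
    using x y by auto
  have leaves_s: "leaves s = Suc (leaves u)"
    using y(1) by (simp add: s)
  have k: "k < leaves u" "Suc l < leaves (graft u k (cherry i))" "Suc (Suc l) < length ws"
    using y x leaves_s assms(3) by auto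
  have x': "x = (graft (graft u k (cherry i)) (Suc l) (cherry j), ws)"
    using graft_cherry_commute[OF assms(3) y(1), of j i] x by (simp add: s)
  have merge: "merge l j vs = merge k i (merge (Suc l) j ws)"
    unfolding vs using merge_commute[of k "Suc l" ws i j] assms(3) k(3) by simp
  have "vs ! l = ws ! Suc l" "vs ! Suc l = ws ! Suc (Suc l)"
    using k(3) x(3) assms(3) by (auto simp: vs nth_merge)
  then have "alg_op j (ws ! Suc l) (ws ! Suc (Suc l)) \<in> good_words I Z B"
    using merged_in_set[OF y(3), of j] y(5,6) by (auto simp: good_cells_def)
  then have "set (merge (Suc l) j ws) \<subseteq> good_words I Z B"
    using set_merge[of "Suc l" ws j] x(4,6) k(3) by (auto simp: good_cells_def)
  moreover have "length (merge (Suc l) j ws) = leaves (graft u k (cherry i))"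
    using x(2) k leaves_s by simp
  ultimately have G: "(graft u k (cherry i), merge (Suc l) j ws) \<in> G"
    by (rule good_cellsI_graft[OF x(6)[unfolded x'] k(2)])
  then show ?thesis
  proof (intro exI conjI)
    show "match (Suc l) x (graft u k (cherry i), merge (Suc l) j ws)"
      unfolding x' using k(2) x(6)[unfolded x'] G by (rule matchI)
    show "match k (graft u k (cherry i), merge (Suc l) j ws) z"
      unfolding y(5) merge using k(1) G y(6)[unfolded y(5) merge] by (rule matchI)
  qed
qed

lemma match_confluence:
  assumes "match k x y" "match l x y'" "l < k"
  shows "Suc l < k \<and> (\<exists>z. match l y z \<and> match (k - 1) y' z)"
proof -
  from assms(1) obtain s i ws where x: "k < leaves s" "length ws = Suc (leaves s)"
    "Suc k < length ws" "x = (graft s k (cherry i), ws)" "y = (s, merge k i ws)" "x \<in> G" "y \<in> G"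
    by (rule matchE)
  from assms(2) obtain s' j ws' where y: "l < leaves s'" "Suc l < length ws'"
    "x = (graft s' l (cherry j), ws')" "y' = (s', merge l j ws')" "y' \<in> G"
    by (rule matchE)
  have ws': "ws' = ws" and eq: "graft s k (cherry i) = graft s' l (cherry j)"
    using x y by auto
  obtain u where u: "Suc l < k" "k - 1 < leaves u" "s = graft u l (cherry j)"
      "s' = graft u (k - 1) (cherry i)"
    using two_cherries[OF x(1) y(1) assms(3) eq] by blast
  have l: "l < leaves u" "leaves s = Suc (leaves u)"
    using u by auto
  have merge: "merge l j (merge k i ws) = merge (k - 1) i (merge l j ws)"
    using u(1) x(3) by (rule merge_commute)
  have good: "set (merge k i ws) \<subseteq> good_words I Z B" "set (merge l j ws) \<subseteq> good_words I Z B"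
    using x(5,7) y(4,5) ws' by (auto simp: good_cells_def)
  have "merge k i ws ! l = ws ! l" "merge k i ws ! Suc l = ws ! Suc l"
    using x(3) u(1) by (auto simp: nth_merge)
  moreover have "alg_op j (ws ! l) (ws ! Suc l) \<in> good_words I Z B"
    using merged_in_set[of l ws j] good(2) x(3) u(1) by auto
  moreover have "Suc l < length (merge k i ws)"
    using x(3) u(1) by simp
  ultimately have "set (merge l j (merge k i ws)) \<subseteq> good_words I Z B"
    using set_merge[of l "merge k i ws" j] good(1) by auto
  moreover have "length (merge l j (merge k i ws)) = leaves u"
    using x(2,3) u(1) l by simp
  moreover have "(graft u l (cherry j), merge k i ws) \<in> G"
    using x(5,7) u(3) by simp
  ultimately have z: "(u, merge l j (merge k i ws)) \<in> G"
    using good_cellsI_graft[OF _ l(1)] by blast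
  then show ?thesis
    using matchI[OF l(1), of j "merge k i ws"] matchI[OF u(2), of i "merge l j ws"] x(5,7) y(4,5)
      ws' u merge by auto
qed

text \<open>
  Whether the word at the leaf \<open>l\<close> can be expanded depends only on this word and on the parent of the
  leaf \<open>l\<close>, and neither is affected by merging at a later position.
\<close>

lemma match_coconfluence:
  assumes "match k x y" "match l y' y" "l < k"
  shows "\<exists>x'. match l x' x"
proof -
  from assms(1) obtain s i ws where x: "k < leaves s" "length ws = Suc (leaves s)"
    "Suc k < length ws" "x = (graft s k (cherry i), ws)" "y = (s, merge k i ws)" "x \<in> G"
    by (rule matchE)
  from assms(2) obtain s' j vs where y': "l < leaves s'" "Suc l < length vs"
    "y' = (graft s' l (cherry j), vs)" "y = (s', merge l j vs)" "y' \<in> G"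
    by (rule matchE)
  have eq: "s' = s" "merge k i ws = merge l j vs"
    using x y' by auto
  have "ws ! l = merge k i ws ! l"
    using x(3) assms(3) by (simp add: nth_merge)
  also have "\<dots> = alg_op j (vs ! l) (vs ! Suc l)"
    using y'(2) by (simp add: eq nth_merge)
  finally obtain p q us where w: "ws ! l = (Node j p q, us)"
    by (cases "vs ! l"; cases "vs ! Suc l") auto
  have "link (parents None s ! l) (cherry j) \<subseteq> Z"
    using y' eq(1) edges_graft[of l s "cherry j"] by (auto simp: good_cells_def)
  then have "link (parents None (graft s k (cherry i)) ! l) (Node j p q) \<subseteq> Z"
    using nth_parents_graft_cherry(1)[OF x(1) assms(3)] link_Node_cong[of _ j p q Leaf Leaf] by simp
  moreover have "l < leaves (graft s k (cherry i))"
    using x(1) assms(3) by simp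
  ultimately show ?thesis
    using match_expand[of "graft s k (cherry i)" ws l j p q us] w x(4,6) by simp
qed

sublocale matchings "\<lambda>x. leaves (fst x)" dn up
proof
  show "up k y = Some x \<longleftrightarrow> dn k x = Some y" for k x y
    by (simp add: up_eq_Some_iff dn_eq_Some_iff)
  show "leaves (fst x) = Suc (leaves (fst y)) \<and> k < leaves (fst y)" if "dn k x = Some y" for k x y
    using that by (auto simp: dn_eq_Some_iff match_def step_def)
  show "up l x \<noteq> None" if "dn k x = Some y" "up l y \<noteq> None" "l < k" for k x y l
    using match_coconfluence[of k x y l] that by (auto simp: dn_eq_Some_iff up_eq_Some_iff)
  show "l \<noteq> k \<and> Suc l \<noteq> k" if "dn k x = Some y" "dn l y = Some z" for k x y l z
    using match_no_nesting that unfolding dn_eq_Some_iff by blast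
  show "\<exists>y'. dn l x = Some y' \<and> dn (k - 1) y' = Some z"
    if "dn k x = Some y" "dn l y = Some z" "Suc l < k" for k x y l z
    using match_swap_left that unfolding dn_eq_Some_iff by blast
  show "\<exists>y'. dn (Suc l) x = Some y' \<and> dn k y' = Some z"
    if "dn k x = Some y" "dn l y = Some z" "k < l" for k x y l z
    using match_swap_right that unfolding dn_eq_Some_iff by blast
  show "Suc l < k \<and> (\<exists>z. dn l y = Some z \<and> dn (k - 1) y' = Some z)"
    if "dn k x = Some y" "dn l x = Some y'" "l < k" for k x y l y'
    using match_confluence that unfolding dn_eq_Some_iff by blast
qed

text \<open>
  If merging at a cherry creates an edge in \<open>Z\<close>, then this edge links the cherry to the root vertex of
  one of the two words, and this word can be expanded instead.
\<close>

lemma exists_active: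
  assumes G: "(t, ws) \<in> G" and nontrivial: "t \<noteq> Leaf \<or> (\<exists>i p q us. ws = [(Node i p q, us)])"
  shows "\<exists>k. active (t, ws) k"
proof -
  have expand: "active (t, ws) m"
    if m: "m < leaves t" "link (parents None t ! m) (fst (ws ! m)) \<subseteq> Z" "fst (ws ! m) \<noteq> Leaf" for m
  proof -
    obtain j p q us where "ws ! m = (Node j p q, us)"
      using m(3) by (cases "ws ! m"; cases "fst (ws ! m)") auto
    then obtain x where "match m x (t, ws)"
      using match_expand[OF G m(1)] m(2) by auto
    then have "up m (t, ws) = Some x"
      by (rule up_eq_Some_iff[THEN iffD2])
    then show ?thesis
      by (simp add: active_def)
  qed
  show ?thesis
  proof (cases "t = Leaf")
    case True
    then show ?thesis
      using expand[of 0] nontrivial by auto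
  next
    case False
    then obtain s k i where k: "k < leaves s" and t: "t = graft s k (cherry i)"
      using exists_cherry[of t] two_le_leaves_Node by (metis pbt.exhaust)
    have len: "length ws = Suc (leaves s)" "Suc k < leaves t"
      using G k t by (auto simp: good_cells_def)
    show ?thesis
    proof (cases "link (Some (TR, i)) (fst (ws ! k)) \<inter> Z = {} \<and>
        link (Some (TL, i)) (fst (ws ! Suc k)) \<inter> Z = {}")
      case True
      have ws: "set ws \<subseteq> good_words I Z B" and "i \<in> I"
        using G k t by (auto simp: good_cells_def)
      have good: "ws ! k \<in> good_words I Z B" "ws ! Suc k \<in> good_words I Z B"
        using k len(1) by (auto intro!: subsetD[OF ws] nth_mem)
      then have "alg_op i (ws ! k) (ws ! Suc k) \<in> words I B"
        using good_words_subset \<open>i \<in> I\<close> by (intro alg_op_in_words) auto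
      moreover have "edges (fst (alg_op i (ws ! k) (ws ! Suc k))) \<inter> Z = {}"
        using True good unfolding edges_alg_op good_words_def by blast
      ultimately have "alg_op i (ws ! k) (ws ! Suc k) \<in> good_words I Z B"
        by (simp add: good_words_def)
      then have "set (merge k i ws) \<subseteq> good_words I Z B"
        using set_merge[of k ws i] ws k len(1) by auto
      moreover have "length (merge k i ws) = leaves s"
        using k len(1) by simp
      ultimately have "(s, merge k i ws) \<in> G"
        by (rule good_cellsI_graft[OF G[unfolded t] k])
      then have "match k (t, ws) (s, merge k i ws)"
        unfolding t by (rule matchI[OF k G[unfolded t]])
      then have "dn k (t, ws) = Some (s, merge k i ws)"
        by (rule dn_eq_Some_iff[THEN iffD2])
      then have "active (t, ws) k"
        by (simp add: active_def)
      then show ?thesis ..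
    next
      case False
      have link: "link (Some q) w \<subseteq> Z \<and> w \<noteq> Leaf" if "link (Some q) w \<inter> Z \<noteq> {}"
        for q and w :: "'i pbt"
        using that by (cases "(Some q, w)" rule: link.cases) auto
      from False consider "link (Some (TR, i)) (fst (ws ! k)) \<inter> Z \<noteq> {}"
        | "link (Some (TL, i)) (fst (ws ! Suc k)) \<inter> Z \<noteq> {}"
        by blast
      then show ?thesis
      proof cases
        case 1
        then have "active (t, ws) k"
          using link[OF 1] len(2) nth_parents_graft_cherry(2)[OF k, of None i]
          by (intro expand) (auto simp: t)
        then show ?thesis ..
      next
        case 2
        then have "active (t, ws) (Suc k)"
          using link[OF 2] len(2) nth_parents_graft_cherry(3)[OF k, of None i]
          by (intro expand) (auto simp: t)
        then show ?thesis ..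
      qed
    qed
  qed
qed

end

section \<open>The differential on cells\<close>

lemma finite_trees: "finite I \<Longrightarrow> finite (trees I n)"
proof (induction n rule: less_induct)
  case (less n)
  have "trees I n \<subseteq> insert Leaf ((\<lambda>(i, l, r). Node i l r) `
      (I \<times> (\<Union>m\<in>{..<n}. trees I m) \<times> (\<Union>m\<in>{..<n}. trees I m)))"
  proof
    fix t assume t: "t \<in> trees I n"
    show "t \<in> insert Leaf ((\<lambda>(i, l, r). Node i l r) `
      (I \<times> (\<Union>m\<in>{..<n}. trees I m) \<times> (\<Union>m\<in>{..<n}. trees I m)))"
    proof (cases t)
      case (Node i l r)
      then have "i \<in> I" "l \<in> trees I (leaves l)" "r \<in> trees I (leaves r)" "leaves l + leaves r = n"
        using t by (auto simp: trees_def)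
      moreover from this have "leaves l < n" "leaves r < n"
        using leaves_pos[of l] leaves_pos[of r] by linarith+
      ultimately show ?thesis
        using Node by (intro insertI2 image_eqI[of _ _ "(i, l, r)"]) auto
    qed simp
  qed
  moreover have "finite (I \<times> (\<Union>m\<in>{..<n}. trees I m) \<times> (\<Union>m\<in>{..<n}. trees I m))"
    using less by auto
  ultimately show ?case
    using finite_subset by blast
qed

lemma precomp_basis:
  "precomp I m k (generator i) (basis t) =
    (\<Sum>s\<in>trees I m. if graft s k (cherry i) = t then basis s else 0)"
  unfolding precomp_def
  by (intro sum.cong) (auto simp: comp_op_def generator_def lookup_single when_def)

lemma precomp_graft:
  assumes "finite I" "s \<in> trees I m" "k < m"
  shows "precomp I m k (generator i) (basis (graft s k (cherry j))) = (if i = j then basis s else 0)"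
proof -
  have "graft s' k (cherry i) = graft s k (cherry j) \<longleftrightarrow> s' = s \<and> i = j" if "s' \<in> trees I m" for s'
    using graft_cherry_inject[of k s' s i j] that assms by (auto simp: trees_def)
  then have "precomp I m k (generator i) (basis (graft s k (cherry j)) :: 'a pbt \<Rightarrow>\<^sub>0 'b) =
      (\<Sum>s'\<in>trees I m. if s' = s then if i = j then basis s else 0 else 0)"
    unfolding precomp_basis by (intro sum.cong) auto
  then show ?thesis
    using finite_trees[OF assms(1)] assms(2) by simp
qed

lemma precomp_eq_0:
  assumes "\<And>s. k < leaves s \<Longrightarrow> t \<noteq> graft s k (cherry i)" "k < m"
  shows "precomp I m k (generator i) (basis t) = 0"
  unfolding precomp_basis using assms by (intro sum.neutral) (auto simp: trees_def)

lemma cells_altdef: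
  assumes "Z \<subseteq> UNIV \<times> I \<times> I"
  shows "cells I Z B n = {(t, ws). labels t \<subseteq> I \<and> leaves t = n \<and> edges t \<subseteq> Z \<and> length ws = n \<and>
    set ws \<subseteq> words I B}"
proof -
  have "edges t \<inter> (UNIV \<times> I \<times> I - Z) = {} \<longleftrightarrow> edges t \<subseteq> Z" if "labels t \<subseteq> I" for t
  proof -
    have "edges t \<subseteq> UNIV \<times> I \<times> I"
      using edges_subset[of t] that by blast
    then show ?thesis
      using assms by blast
  qed
  then show ?thesis
    by (auto simp: cells_def good_trees_def trees_def)
qed

lemma koszul_diff_eq_lin_ext:
  "koszul_diff P c = lin_ext (\<lambda>x. koszul_diff P (basis x)) c"
  by (simp add: koszul_diff_def case_prod_unfold)

lemma koszul_diff_basis: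
  fixes I :: "'i set" and B :: "'v set"
  assumes "finite I" "x \<in> cells I Z B n"
  shows "koszul_diff (monomial_operad I Z :: ('i, 'k::field) quadratic) (basis x) =
    (\<Sum>k<n - 1. scale (sgn_pow k) (osingle (face k x)))"
proof -
  obtain t ws where x: "x = (t, ws)"
    by (cases x)
  then have t: "t \<in> trees I n" "length ws = n"
    using assms(2) by (auto simp: cells_def good_trees_def)
  have "(\<Sum>i\<in>I. scale (sgn_pow k)
      (tensor (precomp I (n - 1) k (generator i) (basis t)) (basis (merge k i ws)))) =
      (scale (sgn_pow k) (osingle (face k x)) :: ('i, 'v, 'k) chain)" if k: "k < n - 1" for k
  proof (cases "face k x")
    case None
    then have "t \<noteq> graft s k (cherry i)" if "k < leaves s" for s i
      using that by (auto simp: face_def pick_eq_None_iff step_def x)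
    then show ?thesis
      using None k by (simp add: precomp_eq_0)
  next
    case (Some y)
    then obtain s j where s: "k < leaves s" "t = graft s k (cherry j)" "y = (s, merge k j ws)"
      by (auto simp: face_eq_Some_iff step_def x)
    then have "s \<in> trees I (n - 1)" "j \<in> I"
      using t by (auto simp: trees_def)
    then have "(\<Sum>i\<in>I. scale (sgn_pow k)
        (tensor (precomp I (n - 1) k (generator i) (basis t)) (basis (merge k i ws)))) =
        (\<Sum>i\<in>I. if i = j then scale (sgn_pow k) (basis y :: ('i, 'v, 'k) chain) else 0)"
      using s k by (intro sum.cong) (auto simp: precomp_graft[OF assms(1)])
    then show ?thesis
      using Some \<open>j \<in> I\<close> assms(1) by simp
  qed
  moreover have "koszul_diff (monomial_operad I Z :: ('i, 'k) quadratic) (basis x) =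
      (\<Sum>k<n - 1. \<Sum>i\<in>I. scale (sgn_pow k)
        (tensor (precomp I (n - 1) k (generator i) (basis t)) (basis (merge k i ws))))"
    by (simp add: koszul_diff_def x t(2) monomial_operad_def merge_def)
  ultimately show ?thesis
    by simp
qed

lemma null_cells_subset: "null_cells I Z B n \<subseteq> cells I Z B n"
  by (auto simp: null_cells_def)

locale koszul_cells = cell_matching I Z B
  for I :: "'i set" and Z :: "(Y2 \<times> 'i \<times> 'i) set" and B :: "'v set" +
  assumes finite_I: "finite I" and Z_subset: "Z \<subseteq> UNIV \<times> I \<times> I"
begin

abbreviation "C \<equiv> cells I Z B"
abbreviation "N \<equiv> null_cells I Z B"
abbreviation "P \<equiv> monomial_operad I Z"

lemma leaves_cell: "x \<in> C n \<Longrightarrow> leaves (fst x) = n"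
  by (auto simp: cells_altdef[OF Z_subset])

lemma good_cells_eq: "C n - N n = {x \<in> G. leaves (fst x) = n}"
proof -
  have "set ws \<subseteq> good_words I Z B \<longleftrightarrow>
      set ws \<subseteq> words I B \<and> set ws \<inter> bad_words I Z B = {}" for ws
    unfolding good_words_eq by blast
  then show ?thesis
    unfolding null_cells_def cells_altdef[OF Z_subset] good_cells_def by auto
qed

lemma step_in_cells: "x \<in> C n \<Longrightarrow> step k x y \<Longrightarrow> y \<in> C (n - 1)"
proof -
  assume x: "x \<in> C n" and "step k x y"
  then obtain s i ws where s: "k < leaves s" "x = (graft s k (cherry i), ws)" "y = (s, merge k i ws)"
    by (cases x) (auto simp: step_def)
  then have ws: "length ws = n" "n = Suc (leaves s)" "set ws \<subseteq> words I B" "i \<in> I"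
    using x by (auto simp: cells_altdef[OF Z_subset])
  then have "alg_op i (ws ! k) (ws ! Suc k) \<in> words I B"
    using s(1) by (intro alg_op_in_words subsetD[OF ws(3)]) auto
  then have "set (merge k i ws) \<subseteq> words I B"
    using set_merge[of k ws i] ws s(1) by auto
  then show ?thesis
    using x s ws by (auto simp: cells_altdef[OF Z_subset] edges_graft)
qed

lemma step_in_null_cells: "x \<in> N n \<Longrightarrow> step k x y \<Longrightarrow> y \<in> N (n - 1)"
proof -
  assume x: "x \<in> N n" and step: "step k x y"
  have y: "y \<in> C (n - 1)"
    using step_in_cells step x null_cells_subset by blast
  obtain s i ws where s: "k < leaves s" "x = (graft s k (cherry i), ws)" "y = (s, merge k i ws)"
    using step by (cases x) (auto simp: step_def)
  obtain w where w: "w \<in> set ws" "w \<in> bad_words I Z B"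
    using x s by (auto simp: null_cells_def)
  have len: "Suc k < length ws"
    using x s by (auto simp: null_cells_def cells_altdef[OF Z_subset])
  have in_words: "set (merge k i ws) \<subseteq> words I B"
    using y s by (auto simp: cells_def)
  have "set (merge k i ws) \<inter> bad_words I Z B \<noteq> {}"
  proof (cases "w = ws ! k \<or> w = ws ! Suc k")
    case True
    then have "edges (fst w) \<subseteq> edges (fst (alg_op i (ws ! k) (ws ! Suc k)))"
      by (auto simp: edges_alg_op)
    then have "alg_op i (ws ! k) (ws ! Suc k) \<in> bad_words I Z B"
      using w(2) subsetD[OF in_words merged_in_set[OF len]] unfolding bad_words_iff by blast
    then show ?thesis
      using merged_in_set[OF len] by blast
  next
    case False
    then show ?thesis
      using set_subset_set_merge[OF len w(1)] w(2) by blast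
  qed
  then show ?thesis
    using y s by (auto simp: null_cells_def)
qed

lemma dn_eq_None: "x \<notin> G \<Longrightarrow> dn k x = None"
  by (simp add: dn_def pick_eq_None_iff match_def)

lemma bd_null: "x \<in> N n \<Longrightarrow> bd x = 0"
proof -
  assume "x \<in> N n"
  then have "x \<notin> G"
    using good_cells_eq[of n] leaves_cell[of x n] null_cells_subset[of I Z B n] by blast
  then show ?thesis
    by (simp add: bd_def dn_eq_None)
qed

lemma bd_in_vspace: "x \<in> C n \<Longrightarrow> bd x \<in> vspace (C (n - 1) - N (n - 1))"
proof -
  assume x: "x \<in> C n"
  have "osingle (dn k x) \<in> vspace (C (n - 1) - N (n - 1))" for k
  proof (rule osingle_in_vspace)
    fix y assume y: "dn k x = Some y"
    then have "y \<in> G" "leaves (fst y) = n - 1"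
      using deg_dn[OF y] leaves_cell[OF x] by (auto simp: dn_eq_Some_iff match_def)
    then show "y \<in> C (n - 1) - N (n - 1)"
      by (simp add: good_cells_eq)
  qed
  then show ?thesis
    unfolding bd_def by (intro vspace_sum vspace_scale)
qed

lemma ht_in_vspace: "x \<in> C n \<Longrightarrow> ht x \<in> vspace (C (n + 1) - N (n + 1))"
proof -
  assume x: "x \<in> C n"
  have "osingle (up k x) \<in> vspace (C (n + 1) - N (n + 1))" for k
  proof (rule osingle_in_vspace)
    fix y assume "up k x = Some y"
    then have "dn k y = Some x"
      by (simp add: up_iff)
    then have "y \<in> G" "leaves (fst y) = n + 1"
      using deg_dn[of k y x] leaves_cell[OF x] by (auto simp: dn_eq_Some_iff match_def)
    then show "y \<in> C (n + 1) - N (n + 1)"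
      by (simp add: good_cells_eq)
  qed
  then show ?thesis
    by (auto simp: ht_def Let_def intro: vspace_scale)
qed

text \<open>
  Modulo null chains, the Koszul differential is the boundary of the matchings; \<open>bd\<close> vanishes on cells
  that are not good.
\<close>

lemma koszul_diff_basis_eq_bd:
  assumes x: "x \<in> C n"
  shows "koszul_diff P (basis x) - bd x \<in> vspace (N (n - 1))"
proof -
  have "osingle (face k x) - osingle (dn k x) \<in> vspace (N (n - 1))" for k
  proof (cases "face k x")
    case None
    then have "dn k x = None"
      by (auto simp: face_def dn_def pick_eq_None_iff match_def)
    then show ?thesis
      using None by simp
  next
    case (Some y)
    then have step: "step k x y"
      by (simp add: face_eq_Some_iff)
    then have y: "y \<in> C (n - 1)"
      using x step_in_cells by blast
    show ?thesis
    proof (cases "x \<in> G \<and> y \<in> G")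
      case True
      then have "dn k x = Some y"
        using step by (simp add: dn_eq_Some_iff match_def)
      then show ?thesis
        using Some by simp
    next
      case False
      then have "y \<in> N (n - 1)"
        using x y step step_in_null_cells good_cells_eq[of n] good_cells_eq[of "n - 1"]
          leaves_cell by blast
      moreover have "dn k x = None"
        using False step_unique[OF step] unfolding dn_def pick_eq_None_iff match_def by blast
      ultimately show ?thesis
        using Some by simp
    qed
  qed
  then have "(\<Sum>k<n - 1. scale (sgn_pow k) (osingle (face k x) - osingle (dn k x))) \<in> vspace (N (n - 1))"
    by (intro vspace_sum vspace_scale)
  then show ?thesis
    by (simp add: koszul_diff_basis[OF finite_I x] bd_def leaves_cell[OF x]
        free_vs.scale_right_diff_distrib sum_subtractf)
qed

lemma koszul_diff_eq_bd:
  assumes "c \<in> vspace (C n)"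
  shows "koszul_diff P c - lin_ext bd c \<in> vspace (N (n - 1))"
proof -
  have "lin_ext (\<lambda>x. koszul_diff P (basis x) - bd x) c \<in> vspace (N (n - 1))"
    using assms koszul_diff_basis_eq_bd by (rule lin_ext_in_vspace)
  then show ?thesis
    by (simp add: lin_ext_diff_fun flip: koszul_diff_eq_lin_ext)
qed

section \<open>Cycles and boundaries\<close>

lemma lin_ext_bd_null: "e \<in> vspace (N n) \<Longrightarrow> lin_ext bd e = 0"
  unfolding lin_ext_def by (intro sum.neutral) (auto dest!: vspaceD bd_null)

lemma koszul_cycles_eq: "koszul_cycles P B n = {c \<in> vspace (C n). lin_ext bd c = 0}"
proof -
  have "koszul_diff P c \<in> vspace (N (n - 1)) \<longleftrightarrow> lin_ext bd c = 0" if c: "c \<in> vspace (C n)"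
    for c :: "('i, 'v, 'k::field) chain"
  proof
    assume "koszul_diff P c \<in> vspace (N (n - 1))"
    from vspace_diff[OF this koszul_diff_eq_bd[OF c]] have "lin_ext bd c \<in> vspace (N (n - 1))"
      by simp
    moreover have "lin_ext bd c \<in> vspace (C (n - 1) - N (n - 1))"
      using c bd_in_vspace by (rule lin_ext_in_vspace)
    ultimately show "lin_ext bd c = 0"
      by (rule vspace_disjoint) auto
  next
    assume "lin_ext bd c = 0"
    then show "koszul_diff P c \<in> vspace (N (n - 1))"
      using koszul_diff_eq_bd[OF c] by simp
  qed
  then show ?thesis
    unfolding koszul_cycles_def koszul_chains_eq_vspace[OF finite_I Z_subset]
      koszul_null_eq_vspace[OF finite_I Z_subset] by blast
qed

lemma koszul_boundaries_eq:
  "koszul_boundaries P B n = {lin_ext bd b + e | b e. b \<in> vspace (C (n + 1)) \<and> e \<in> vspace (N n)}"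
proof -
  have "\<exists>e'\<in>vspace (N n). koszul_diff P b + e = lin_ext bd b + e'"
    and "\<exists>e'\<in>vspace (N n). lin_ext bd b + e = koszul_diff P b + e'"
    if b: "b \<in> vspace (C (n + 1))" and e: "e \<in> vspace (N n)" for b e :: "('i, 'v, 'k::field) chain"
  proof -
    have d: "koszul_diff P b - lin_ext bd b \<in> vspace (N n)"
      using koszul_diff_eq_bd[OF b] by simp
    show "\<exists>e'\<in>vspace (N n). koszul_diff P b + e = lin_ext bd b + e'"
      using vspace_add[OF e d]
      by (intro bexI[of _ "e + (koszul_diff P b - lin_ext bd b)"]) (auto simp: algebra_simps)
    show "\<exists>e'\<in>vspace (N n). lin_ext bd b + e = koszul_diff P b + e'"
      using vspace_diff[OF e d]
      by (intro bexI[of _ "e - (koszul_diff P b - lin_ext bd b)"]) (auto simp: algebra_simps)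
  qed
  then show ?thesis
    unfolding koszul_boundaries_def koszul_chains_eq_vspace[OF finite_I Z_subset]
      koszul_null_eq_vspace[OF finite_I Z_subset] by blast
qed

lemma subspace_boundaries: "free_vs.subspace (koszul_boundaries P B n :: ('i, 'v, 'k::field) chain set)"
proof -
  have eq: "koszul_boundaries P B n =
      {x + y | x y. x \<in> lin_ext bd ` vspace (C (n + 1)) \<and> y \<in> (vspace (N n) :: ('i, 'v, 'k) chain set)}"
    unfolding koszul_boundaries_eq by blast
  have "free_vs.subspace (lin_ext bd ` vspace (C (n + 1)) :: ('i, 'v, 'k) chain set)"
  proof (rule free_vs.subspaceI)
    show "0 \<in> lin_ext bd ` vspace (C (n + 1))"
      by (rule image_eqI[of _ _ 0]) auto
    show "x + y \<in> lin_ext bd ` vspace (C (n + 1))"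
      if "x \<in> lin_ext bd ` vspace (C (n + 1))" "y \<in> lin_ext bd ` vspace (C (n + 1))"
      for x y :: "('i, 'v, 'k) chain"
      using that by (auto simp flip: lin_ext_add)
    show "scale c x \<in> lin_ext bd ` vspace (C (n + 1))"
      if "x \<in> lin_ext bd ` vspace (C (n + 1))" for c and x :: "('i, 'v, 'k) chain"
      using that by (auto simp flip: lin_ext_scale)
  qed
  then show ?thesis
    unfolding eq by (intro free_vs.subspace_sums subspace_vspace)
qed

text \<open>
  The form of the homotopy identity that is used for chains: summed over the basis elements of a cycle,
  the term \<open>lin_ext ht (bd x)\<close> vanishes.
\<close>

lemma basis_in_boundaries:
  assumes x: "x \<in> G" and deg: "leaves (fst x) = n" and nontrivial: "fst x \<noteq> Leaf \<or>
    (\<exists>i p q us. snd x = [(Node i p q, us)])"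
  shows "basis x - lin_ext ht (bd x) \<in> koszul_boundaries P B n"
proof -
  have C: "x \<in> C n"
    using x deg good_cells_eq[of n] by blast
  obtain k where "active x k"
    using exists_active[of "fst x" "snd x"] x nontrivial by auto
  then have "basis x - lin_ext ht (bd x) = lin_ext bd (ht x) + 0"
    using homotopy[of x k] by (metis add.right_neutral add_diff_cancel_right')
  moreover have "ht x \<in> vspace (C (n + 1))"
    using ht_in_vspace[OF C] vspace_mono[of "C (n + 1) - N (n + 1)" "C (n + 1)"] by blast
  ultimately show ?thesis
    unfolding koszul_boundaries_eq by blast
qed

lemma null_in_boundaries: "e \<in> vspace (N n) \<Longrightarrow> e \<in> koszul_boundaries P B n"
  unfolding koszul_boundaries_eq by (intro CollectI exI[of _ 0] exI[of _ e]) auto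

lemma cycles_eq_boundaries:
  assumes "2 \<le> n"
  shows "koszul_cycles P B n = (koszul_boundaries P B n :: ('i, 'v, 'k::field) chain set)"
proof
  show "koszul_cycles P B n \<subseteq> (koszul_boundaries P B n :: ('i, 'v, 'k::field) chain set)"
  proof
    fix c :: "('i, 'v, 'k) chain"
    assume "c \<in> koszul_cycles P B n"
    then have c: "c \<in> vspace (C n)" "lin_ext bd c = 0"
      by (auto simp: koszul_cycles_eq)
    have "basis x - lin_ext ht (bd x) \<in> (koszul_boundaries P B n :: ('i, 'v, 'k) chain set)"
      if "x \<in> C n" for x
    proof (cases "x \<in> N n")
      case True
      then show ?thesis
        using null_in_boundaries[OF vspace_single] by (simp add: bd_null)
    next
      case False
      then have x: "x \<in> G" "leaves (fst x) = n"
        using that good_cells_eq[of n] by blast+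
      then have "fst x \<noteq> Leaf"
        using assms by (cases x) auto
      then show ?thesis
        using basis_in_boundaries[OF x] by blast
    qed
    then have "lin_ext (\<lambda>x. basis x - lin_ext ht (bd x)) c \<in> koszul_boundaries P B n"
      unfolding lin_ext_def[of _ c] using c(1) subspace_boundaries
      by (intro free_vs.subspace_sum free_vs.subspace_scale) (auto dest: vspaceD)
    then show "c \<in> koszul_boundaries P B n"
      by (simp add: lin_ext_diff_fun lin_ext_basis c(2) flip: lin_ext_lin_ext)
  qed
  show "koszul_boundaries P B n \<subseteq> (koszul_cycles P B n :: ('i, 'v, 'k::field) chain set)"
  proof
    fix c :: "('i, 'v, 'k) chain"
    assume "c \<in> koszul_boundaries P B n"
    then obtain b e where c: "c = lin_ext bd b + e" "b \<in> vspace (C (n + 1))" "e \<in> vspace (N n)"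
      by (auto simp: koszul_boundaries_eq)
    have "lin_ext bd b \<in> vspace (C n - N n)"
      using c(2) bd_in_vspace[of _ "n + 1"] by (intro lin_ext_in_vspace) auto
    then have "c \<in> vspace (C n)"
      using c vspace_mono[of "C n - N n" "C n"] vspace_mono[OF null_cells_subset[of I Z B n]]
      by blast
    moreover have "lin_ext bd c = 0"
      by (simp add: c(1) lin_ext_add lin_ext_lin_ext bd_bd lin_ext_bd_null[OF c(3)])
    ultimately show "c \<in> koszul_cycles P B n"
      by (simp add: koszul_cycles_eq)
  qed
qed

section \<open>Homology in degree one\<close>

text \<open>
  The cell of degree one that is given by a basis element of the vector space.  The good cells without
  an active position are of this form.
\<close>

definition trivial_cell :: "'v \<Rightarrow> 'i pbt \<times> ('i pbt \<times> 'v list) list" where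
  "trivial_cell b = (Leaf, [(Leaf, [b])])"

lemma koszul_unit_eq: "koszul_unit v = lin_ext (\<lambda>b. basis (trivial_cell b)) v"
  by (simp add: koszul_unit_def bilin_ext_basis_left bilin_ext_basis_right lin_ext_lin_ext
      trivial_cell_def)

lemma koszul_unit_diff: "koszul_unit (v - w) = (koszul_unit v - koszul_unit w :: ('i, 'v, 'k::field) chain)"
  by (simp add: koszul_unit_eq lin_ext_diff)

lemma trivial_cell_in_cells_iff: "trivial_cell b \<in> C (Suc 0) \<longleftrightarrow> b \<in> B"
  by (auto simp: trivial_cell_def cells_altdef[OF Z_subset] words_def trees_def)

lemma koszul_unit_in_cycles:
  assumes "v \<in> vspace B"
  shows "(koszul_unit v :: ('i, 'v, 'k::field) chain) \<in> koszul_cycles P B 1"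
proof -
  have "koszul_unit v \<in> vspace (C 1)"
    unfolding koszul_unit_eq using assms by (rule lin_ext_in_vspace) (simp add: trivial_cell_in_cells_iff)
  moreover have "lin_ext bd (koszul_unit v) = (0 :: ('i, 'v, 'k) chain)"
    by (simp add: koszul_unit_eq lin_ext_lin_ext bd_def trivial_cell_def)
  ultimately show ?thesis
    by (simp add: koszul_cycles_eq)
qed

text \<open>
  A trivial cell is neither a face, as a face of degree one has a word that was merged, nor a null cell.
\<close>

lemma boundaries_1_subset: "koszul_boundaries P B 1 \<subseteq> vspace (- range trivial_cell)"
proof
  fix c :: "('i, 'v, 'k::field) chain"
  assume "c \<in> koszul_boundaries P B 1"
  then obtain b e where c: "c = lin_ext bd b + e" "e \<in> vspace (N 1)"
    by (auto simp: koszul_boundaries_eq)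
  have "y \<notin> range trivial_cell" if y: "dn k x = Some y" for k x y
  proof -
    obtain s i ws where s: "k < leaves s" "y = (s, merge k i ws)" "Suc k < length ws"
      using y unfolding dn_eq_Some_iff by (rule matchE)
    obtain p q us where "alg_op i (ws ! k) (ws ! Suc k) = (Node i p q, us)"
      by (cases "ws ! k"; cases "ws ! Suc k") auto
    then have "(Node i p q, us) \<in> set (snd y)"
      using merged_in_set[OF s(3), of i] s(2) by simp
    then show ?thesis
      by (auto simp: trivial_cell_def)
  qed
  then have "bd x \<in> vspace (- range trivial_cell)" for x
    unfolding bd_def by (intro vspace_sum vspace_scale osingle_in_vspace) auto
  then have "lin_ext bd b \<in> vspace (- range trivial_cell)"
    by (intro lin_ext_in_vspace[of _ UNIV]) (auto simp: vspace_def)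
  moreover have "e \<in> vspace (- range trivial_cell)"
  proof -
    have "N 1 \<subseteq> - range trivial_cell"
      by (auto simp: null_cells_def bad_words_def trivial_cell_def)
    then show ?thesis
      using c(2) vspace_mono by blast
  qed
  ultimately show "c \<in> vspace (- range trivial_cell)"
    unfolding c(1) by (rule vspace_add)
qed

lemma koszul_unit_boundary:
  assumes "(koszul_unit v :: ('i, 'v, 'k::field) chain) \<in> koszul_boundaries P B 1"
  shows "v = 0"
proof -
  have "koszul_unit v \<in> vspace (- range trivial_cell)"
    using assms boundaries_1_subset by blast
  moreover have "koszul_unit v \<in> vspace (range trivial_cell)"
    unfolding koszul_unit_eq by (rule lin_ext_in_vspace[of _ UNIV]) (auto simp: vspace_def)
  ultimately have "koszul_unit v = (0 :: ('i, 'v, 'k) chain)"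
    by (rule vspace_disjoint) auto
  then have "lin_ext (\<lambda>x. basis (inv trivial_cell x)) (lin_ext (\<lambda>b. basis (trivial_cell b)) v) = 0"
    by (simp add: koszul_unit_eq)
  moreover have "inj trivial_cell"
    by (auto simp: inj_def trivial_cell_def)
  ultimately show ?thesis
    by (simp add: lin_ext_lin_ext lin_ext_basis)
qed

lemma koszul_unit_homologous:
  assumes "c \<in> koszul_cycles P B 1"
  shows "\<exists>v\<in>vspace B. c - koszul_unit v \<in> (koszul_boundaries P B 1 :: ('i, 'v, 'k::field) chain set)"
proof -
  have c: "c \<in> vspace (C 1)"
    using assms by (simp add: koszul_cycles_eq)
  define v :: "'i pbt \<times> ('i pbt \<times> 'v list) list \<Rightarrow> ('v \<Rightarrow>\<^sub>0 'k)" where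
    "v x = (if x \<in> range trivial_cell then basis (inv trivial_cell x) else 0)" for x
  have inj: "inj trivial_cell"
    by (auto simp: inj_def trivial_cell_def)
  have "v x \<in> vspace B" if "x \<in> C 1" for x
    using that by (auto simp: v_def inj trivial_cell_in_cells_iff)
  then have "lin_ext v c \<in> vspace B"
    using c by (intro lin_ext_in_vspace)
  moreover have "basis x - koszul_unit (v x) \<in> (koszul_boundaries P B 1 :: ('i, 'v, 'k) chain set)"
    if x: "x \<in> C 1" for x
  proof (cases "x \<in> range trivial_cell")
    case True
    then show ?thesis
      using free_vs.subspace_0[OF subspace_boundaries]
      by (auto simp: v_def koszul_unit_eq inj)
  next
    case False
    have "basis x \<in> (koszul_boundaries P B 1 :: ('i, 'v, 'k) chain set)"
    proof (cases "x \<in> N 1")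
      case True
      then show ?thesis
        by (simp add: null_in_boundaries)
    next
      case not_null: False
      then have G: "x \<in> G" "leaves (fst x) = 1"
        using x good_cells_eq[of 1] by blast+
      obtain t ws where t: "x = (t, ws)"
        by (cases x)
      have "t = Leaf"
      proof (cases t)
        case (Node i l r)
        then show ?thesis
          using G(2) t two_le_leaves_Node[of i l r] by simp
      qed
      moreover obtain s us where "ws = [(s, us)]" "(s, us) \<in> words I B"
        using x t by (auto simp: cells_altdef[OF Z_subset] length_Suc_conv)
      ultimately have "\<exists>i p q us. snd x = [(Node i p q, us)]"
        using False t by (cases s) (auto simp: words_def trees_def trivial_cell_def Suc_length_conv)
      moreover have "bd x = (0 :: ('i, 'v, 'k) chain)"
        using G(2) by (simp add: bd_def)
      ultimately show ?thesis
        using basis_in_boundaries[OF G] by (metis diff_zero lin_ext_0)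
    qed
    then show ?thesis
      using False by (simp add: v_def koszul_unit_eq)
  qed
  then have "lin_ext (\<lambda>x. basis x - koszul_unit (v x)) c \<in> koszul_boundaries P B 1"
    unfolding lin_ext_def[of _ c] using c subspace_boundaries
    by (intro free_vs.subspace_sum free_vs.subspace_scale) (auto dest: vspaceD)
  then have "c - koszul_unit (lin_ext v c) \<in> koszul_boundaries P B 1"
    by (simp add: lin_ext_diff_fun lin_ext_basis koszul_unit_eq lin_ext_lin_ext)
  ultimately show ?thesis
    by blast
qed

lemma homologous_Image:
  "x \<in> koszul_cycles P B n \<Longrightarrow>
    homologous P B n `` {x} = {y \<in> koszul_cycles P B n. x - y \<in> koszul_boundaries P B n}"
  by (auto simp: homologous_def)

lemma homologous_Image_eq:
  assumes "x \<in> koszul_cycles P B n" "y \<in> koszul_cycles P B n"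
  shows "homologous P B n `` {x} = homologous P B n `` {y} \<longleftrightarrow> x - y \<in> koszul_boundaries P B n"
proof -
  note sub = subspace_boundaries[of n]
  show ?thesis
  proof
    assume "homologous P B n `` {x} = homologous P B n `` {y}"
    moreover have "y \<in> homologous P B n `` {y}"
      using assms(2) free_vs.subspace_0[OF sub] by (simp add: homologous_Image)
    ultimately show "x - y \<in> koszul_boundaries P B n"
      using assms(1) by (auto simp: homologous_Image)
  next
    assume xy: "x - y \<in> koszul_boundaries P B n"
    have "x - z \<in> koszul_boundaries P B n \<longleftrightarrow> y - z \<in> koszul_boundaries P B n" for z
      using free_vs.subspace_add[OF sub xy, of "y - z"] free_vs.subspace_diff[OF sub _ xy, of "x - z"]
      by auto
    then show "homologous P B n `` {x} = homologous P B n `` {y}"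
      using assms by (simp add: homologous_Image)
  qed
qed

lemma koszul_acyclic: "koszul_acyclic (monomial_operad I Z :: ('i, 'k::field) quadratic) B"
proof -
  let ?P = "P :: ('i, 'k) quadratic"
  let ?f = "\<lambda>v. homologous ?P B 1 `` {koszul_unit v}"
  have "bij_betw ?f (vspace B) (koszul_homology ?P B 1)"
    unfolding bij_betw_def
  proof
    show "inj_on ?f (vspace B)"
    proof (rule inj_onI)
      fix v w assume "v \<in> vspace B" "w \<in> vspace B" "?f v = ?f w"
      then have "koszul_unit (v - w) \<in> koszul_boundaries ?P B 1"
        using homologous_Image_eq[OF koszul_unit_in_cycles koszul_unit_in_cycles]
        unfolding koszul_unit_diff by blast
      then have "v - w = 0"
        by (rule koszul_unit_boundary)
      then show "v = w"
        by simp
    qed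
    show "?f ` vspace B = koszul_homology ?P B 1"
    proof
      show "?f ` vspace B \<subseteq> koszul_homology ?P B 1"
        using koszul_unit_in_cycles unfolding koszul_homology_def quotient_def by blast
      show "koszul_homology ?P B 1 \<subseteq> ?f ` vspace B"
      proof
        fix h assume "h \<in> koszul_homology ?P B 1"
        then obtain c where c: "c \<in> koszul_cycles ?P B 1" "h = homologous ?P B 1 `` {c}"
          by (auto simp: koszul_homology_def quotient_def)
        obtain v where "v \<in> vspace B" "c - koszul_unit v \<in> koszul_boundaries ?P B 1"
          using koszul_unit_homologous[OF c(1)] by blast
        then show "h \<in> ?f ` vspace B"
          using homologous_Image_eq[OF c(1) koszul_unit_in_cycles] c(2) by blast
      qed
    qed
  qed
  then show ?thesis
    unfolding koszul_acyclic_def using cycles_eq_boundaries by blast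
qed

end

lemma koszul_monomial_operad:
  assumes "finite I" "Z \<subseteq> UNIV \<times> I \<times> I"
  shows "koszul TYPE('v) (monomial_operad I Z)"
  unfolding koszul_def
proof
  fix B :: "'v set"
  interpret koszul_cells I Z B
    using assms by unfold_locales
  show "koszul_acyclic (monomial_operad I Z) B"
    by (rule koszul_acyclic)
qed

theorem theorem4p3:
  fixes I :: "'i set" and X Z :: "(Y2 \<times> 'i \<times> 'i) set"
    and P Q :: "('i, 'k::field) quadratic"
  assumes "finite I"
    and "X \<subseteq> UNIV \<times> I \<times> I"
    and "Z = UNIV \<times> I \<times> I - X"
    and "P = monomial_operad I Z"
    and "Q = monomial_operad I X"
  shows "koszul TYPE('v) P \<and> koszul TYPE('v) Q"
  using assms by (auto intro!: koszul_monomial_operad)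

end
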